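(* Let $G$ be a finitely generated nilpotent group and let $\mu$ be an adapted and smooth probability measure on $G$ (no symmetry or finite support assumed). Assume that $\mu$ is Abelian-centered, i.e. $\mathbf m_{\mathrm{ab}}(\mu):=\sum_{g\in G}\mu(g)[g]=0$ in $G_{\mathrm{ab}}\otimes_{\mathbb Z}\mathbb R$. Then $$\mathrm{HF}_1(G,\mu)=\mathrm{LHF}(G,\mu)=P^1(G).$$ In particular, every $\mu$-harmonic function $f:G\to\mathbb C$ of at most linear growth is affine: there exist $c\in\mathbb C$ and a homomorphism $\varphi\in\mathrm{Hom}(G_{\mathrm{ab}},\mathbb C)$ such that $f(x)=c+\varphi([x])$ for all $x\in G$. Equivalently, $(\varphi,c)\mapsto (x\mapsto c+\varphi([x]))$ gives $\mathrm{LHF}(G,\mu)\cong \mathrm{Hom}(G_{\mathrm{ab}},\mathbb C)\oplus\mathbb C$.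
   Context: Fix a finite symmetric generating set $S$ of $G$ and let $|x|$ be the corresponding word length. $G_{\mathrm{ab}}=G/[G,G]$ and $[x]$ is the class of $x$ in $G_{\mathrm{ab}}$ (or its image in $G_{\mathrm{ab}}\otimes_{\mathbb Z}\mathbb R$). A probability measure $\mu$ on $G$ is adapted if the semigroup generated by $\mathrm{supp}(\mu)$ is $G$; it is smooth if there is $\zeta>0$ with $\sum_{x\in G}\mu(x)e^{\zeta|x|}<\infty$. A function $f:G\to\mathbb C$ is $\mu$-harmonic if for all $k\in G$, $f(k)=\sum_{g\in G}\mu(g)f(kg)$ with absolute convergence. Put $\partial^s f(x)=f(xs)-f(x)$ and $\|\nabla_S f\|_\infty=\sup_{s\in S}\sup_{x\in G}|\partial^s f(x)|$; $f$ is Lipschitz if this is finite (independent of $S$). $\mathrm{LHF}(G,\mu)$ is the vector space of Lipschitz $\mu$-harmonic functions $G\to\mathbb C$. $\mathrm{HF}_1(G,\mu)$ is the space of $\mu$-harmonic $f:G\to\mathbb C$ with $\limsup_{r\to\infty}r^{-1}\max_{|x|\le r}|f(x)|<\infty$ (at most linear growth). $P^1(G)$ is the space of functions $f:G\to\mathbb C$ with $\partial_{u}\partial_{v}f\equiv0$ for all $u,v\in G$, where $\partial_u f(x)=f(ux)-f(x)$ (using right differences gives the same class). *)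

theory Defs
  imports
    "HOL-Probability.Probability_Mass_Function"
    "HOL-Algebra.Generated_Groups"
    "HOL-Algebra.Free_Abelian_Groups"
begin

primrec lower_central :: "('a, 'b) monoid_scheme \<Rightarrow> nat \<Rightarrow> 'a set" where
  "lower_central G 0 = carrier G"
| "lower_central G (Suc n) =
     generate G (\<Union>x \<in> lower_central G n. \<Union>y \<in> carrier G.
       {x \<otimes>\<^bsub>G\<^esub> y \<otimes>\<^bsub>G\<^esub> inv\<^bsub>G\<^esub> x \<otimes>\<^bsub>G\<^esub> inv\<^bsub>G\<^esub> y})"

definition nilpotent_group :: "('a, 'b) monoid_scheme \<Rightarrow> bool" where
  "nilpotent_group G \<longleftrightarrow> group G \<and> (\<exists>n. lower_central G n = {\<one>\<^bsub>G\<^esub>})"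

definition finite_symmetric_generating_set :: "('a, 'b) monoid_scheme \<Rightarrow> 'a set \<Rightarrow> bool" where
  "finite_symmetric_generating_set G S \<longleftrightarrow>
     finite S \<and> S \<subseteq> carrier G \<and> (\<forall>s \<in> S. inv\<^bsub>G\<^esub> s \<in> S) \<and> generate G S = carrier G"

definition word_length :: "('a, 'b) monoid_scheme \<Rightarrow> 'a set \<Rightarrow> 'a \<Rightarrow> nat" where
  "word_length G S x =
     (LEAST n. \<exists>ws. length ws = n \<and> set ws \<subseteq> S \<and> foldr (\<otimes>\<^bsub>G\<^esub>) ws \<one>\<^bsub>G\<^esub> = x)"

inductive_set semigroup_generated :: "('a, 'b) monoid_scheme \<Rightarrow> 'a set \<Rightarrow> 'a set"
  for G :: "('a, 'b) monoid_scheme" and A :: "'a set" where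
  incl: "a \<in> A \<Longrightarrow> a \<in> semigroup_generated G A"
| mult: "x \<in> semigroup_generated G A \<Longrightarrow> y \<in> semigroup_generated G A
     \<Longrightarrow> x \<otimes>\<^bsub>G\<^esub> y \<in> semigroup_generated G A"

definition adapted :: "('a, 'b) monoid_scheme \<Rightarrow> 'a pmf \<Rightarrow> bool" where
  "adapted G \<mu> \<longleftrightarrow> semigroup_generated G (set_pmf \<mu>) = carrier G"

definition smooth_measure :: "('a, 'b) monoid_scheme \<Rightarrow> 'a set \<Rightarrow> 'a pmf \<Rightarrow> bool" where
  "smooth_measure G S \<mu> \<longleftrightarrow>
     (\<exists>\<zeta>>0. (\<lambda>x. pmf \<mu> x * exp (\<zeta> * real (word_length G S x))) summable_on carrier G)"

definition abelianization :: "('a, 'b) monoid_scheme \<Rightarrow> 'a set monoid" where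
  "abelianization G = G Mod derived G (carrier G)"

definition ab_class :: "('a, 'b) monoid_scheme \<Rightarrow> 'a \<Rightarrow> 'a set" where
  "ab_class G x = derived G (carrier G) #>\<^bsub>G\<^esub> x"

text \<open>For an abelian group \<open>A\<close>, the tensor product of \<open>A\<close> with the reals over the integers is the free
  abelian group on the pairs \<open>(a, r)\<close> modulo the bilinearity relations; \<open>pure_tensor A a r\<close> is the
  class of \<open>(a, r)\<close>. The group operations are written multiplicatively.\<close>

definition tensor_relations ::
  "('c, 'd) monoid_scheme \<Rightarrow> ('c \<times> real \<Rightarrow>\<^sub>0 int) set" where
  "tensor_relations A = generate (free_Abelian_group (carrier A \<times> (UNIV :: real set)))
     ({frag_of (a \<otimes>\<^bsub>A\<^esub> b, r) - frag_of (a, r) - frag_of (b, r) | a b r.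
         a \<in> carrier A \<and> b \<in> carrier A} \<union>
      {frag_of (a, r + s) - frag_of (a, r) - frag_of (a, s) | a r s. a \<in> carrier A})"

definition tensor_real ::
  "('c, 'd) monoid_scheme \<Rightarrow> ('c \<times> real \<Rightarrow>\<^sub>0 int) set monoid" where
  "tensor_real A = free_Abelian_group (carrier A \<times> (UNIV :: real set)) Mod tensor_relations A"

definition pure_tensor ::
  "('c, 'd) monoid_scheme \<Rightarrow> 'c \<Rightarrow> real \<Rightarrow> ('c \<times> real \<Rightarrow>\<^sub>0 int) set" where
  "pure_tensor A a r =
     tensor_relations A #>\<^bsub>free_Abelian_group (carrier A \<times> (UNIV :: real set))\<^esub> frag_of (a, r)"

definition real_add_group :: "real monoid" where
  "real_add_group = \<lparr>carrier = UNIV, monoid.mult = (+), one = 0\<rparr>"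

definition complex_add_group :: "complex monoid" where
  "complex_add_group = \<lparr>carrier = UNIV, monoid.mult = (+), one = 0\<rparr>"

text \<open>Scalars act on the tensor product by multiplication in the second factor, so an additive map is
  linear as soon as it respects scalars on pure tensors.\<close>

definition tensor_functionals ::
  "('c, 'd) monoid_scheme \<Rightarrow> (('c \<times> real \<Rightarrow>\<^sub>0 int) set \<Rightarrow> real) set" where
  "tensor_functionals A = {L \<in> hom (tensor_real A) real_add_group.
     \<forall>a \<in> carrier A. \<forall>r s. L (pure_tensor A a (r * s)) = r * L (pure_tensor A a s)}"

text \<open>If \<open>A\<close> is finitely generated then the tensor product is a finite-dimensional real vector space,
  and its usual topology is the coarsest one making all linear functionals continuous.\<close>

definition tensor_topology ::
  "('c, 'd) monoid_scheme \<Rightarrow> ('c \<times> real \<Rightarrow>\<^sub>0 int) set topology" where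
  "tensor_topology A = topology_generated_by
     {{t \<in> carrier (tensor_real A). L t \<in> U} | L U. L \<in> tensor_functionals A \<and> open U}"

definition has_ab_mean ::
  "('a, 'b) monoid_scheme \<Rightarrow> 'a pmf \<Rightarrow> ('a set \<times> real \<Rightarrow>\<^sub>0 int) set \<Rightarrow> bool" where
  "has_ab_mean G \<mu> t \<longleftrightarrow>
     limitin (tensor_topology (abelianization G))
       (\<lambda>X. finprod (tensor_real (abelianization G))
              (\<lambda>g. pure_tensor (abelianization G) (ab_class G g) (pmf \<mu> g)) X)
       t (finite_subsets_at_top (carrier G))"

definition abelian_centered :: "('a, 'b) monoid_scheme \<Rightarrow> 'a pmf \<Rightarrow> bool" where
  "abelian_centered G \<mu> \<longleftrightarrow> has_ab_mean G \<mu> \<one>\<^bsub>tensor_real (abelianization G)\<^esub>"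

text \<open>Functions on \<open>G\<close> are represented by extensional functions on \<open>carrier G\<close>, so that equality of
  function spaces is equality of sets.\<close>

definition harmonic :: "('a, 'b) monoid_scheme \<Rightarrow> 'a pmf \<Rightarrow> ('a \<Rightarrow> complex) \<Rightarrow> bool" where
  "harmonic G \<mu> f \<longleftrightarrow> (\<forall>k \<in> carrier G.
     (\<lambda>g. norm (complex_of_real (pmf \<mu> g) * f (k \<otimes>\<^bsub>G\<^esub> g))) summable_on carrier G \<and>
     f k = (\<Sum>\<^sub>\<infinity>g \<in> carrier G. complex_of_real (pmf \<mu> g) * f (k \<otimes>\<^bsub>G\<^esub> g)))"

definition gradient_norm ::
  "('a, 'b) monoid_scheme \<Rightarrow> 'a set \<Rightarrow> ('a \<Rightarrow> complex) \<Rightarrow> ennreal" where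
  "gradient_norm G S f =
     (SUP s \<in> S. SUP x \<in> carrier G. ennreal (norm (f (x \<otimes>\<^bsub>G\<^esub> s) - f x)))"

definition LHF :: "('a, 'b) monoid_scheme \<Rightarrow> 'a set \<Rightarrow> 'a pmf \<Rightarrow> ('a \<Rightarrow> complex) set" where
  "LHF G S \<mu> = {f \<in> extensional (carrier G). harmonic G \<mu> f \<and> gradient_norm G S f < \<infinity>}"

definition max_on_ball ::
  "('a, 'b) monoid_scheme \<Rightarrow> 'a set \<Rightarrow> ('a \<Rightarrow> complex) \<Rightarrow> nat \<Rightarrow> real" where
  "max_on_ball G S f r = Max ((\<lambda>x. norm (f x)) ` {x \<in> carrier G. word_length G S x \<le> r})"

definition HF1 :: "('a, 'b) monoid_scheme \<Rightarrow> 'a set \<Rightarrow> 'a pmf \<Rightarrow> ('a \<Rightarrow> complex) set" where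
  "HF1 G S \<mu> = {f \<in> extensional (carrier G). harmonic G \<mu> f \<and>
     limsup (\<lambda>r. ereal (max_on_ball G S f r / real r)) < \<infinity>}"

definition left_diff ::
  "('a, 'b) monoid_scheme \<Rightarrow> 'a \<Rightarrow> ('a \<Rightarrow> complex) \<Rightarrow> 'a \<Rightarrow> complex" where
  "left_diff G u f = (\<lambda>x \<in> carrier G. f (u \<otimes>\<^bsub>G\<^esub> x) - f x)"

definition P1 :: "('a, 'b) monoid_scheme \<Rightarrow> ('a \<Rightarrow> complex) set" where
  "P1 G = {f \<in> extensional (carrier G). \<forall>u \<in> carrier G. \<forall>v \<in> carrier G. \<forall>x \<in> carrier G.
     left_diff G u (left_diff G v f) x = 0}"

definition Hom_ab :: "('a, 'b) monoid_scheme \<Rightarrow> ('a set \<Rightarrow> complex) set" where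
  "Hom_ab G = hom (abelianization G) complex_add_group \<inter> extensional (carrier (abelianization G))"

definition affine_fun ::
  "('a, 'b) monoid_scheme \<Rightarrow> ('a set \<Rightarrow> complex) \<Rightarrow> complex \<Rightarrow> 'a \<Rightarrow> complex" where
  "affine_fun G \<phi> c = (\<lambda>x \<in> carrier G. c + \<phi> (ab_class G x))"

definition fun_add :: "'x set \<Rightarrow> ('x \<Rightarrow> complex) \<Rightarrow> ('x \<Rightarrow> complex) \<Rightarrow> 'x \<Rightarrow> complex" where
  "fun_add A f g = (\<lambda>x \<in> A. f x + g x)"

definition fun_scale :: "'x set \<Rightarrow> complex \<Rightarrow> ('x \<Rightarrow> complex) \<Rightarrow> 'x \<Rightarrow> complex" where
  "fun_scale A a f = (\<lambda>x \<in> A. a * f x)"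

definition fun_subspace :: "'x set \<Rightarrow> ('x \<Rightarrow> complex) set \<Rightarrow> bool" where
  "fun_subspace A W \<longleftrightarrow> W \<subseteq> extensional A \<and> (\<lambda>x \<in> A. 0) \<in> W \<and>
     (\<forall>f \<in> W. \<forall>g \<in> W. fun_add A f g \<in> W) \<and> (\<forall>a. \<forall>f \<in> W. fun_scale A a f \<in> W)"

text \<open>\<open>T\<close> is a linear isomorphism from the direct sum of \<open>V\<close> and the complex numbers onto \<open>W\<close>.\<close>

definition linear_iso_sum_complex ::
  "'y set \<Rightarrow> ('y \<Rightarrow> complex) set \<Rightarrow> 'x set \<Rightarrow> ('x \<Rightarrow> complex) set
     \<Rightarrow> (('y \<Rightarrow> complex) \<times> complex \<Rightarrow> 'x \<Rightarrow> complex) \<Rightarrow> bool" where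
  "linear_iso_sum_complex B V A W T \<longleftrightarrow>
     fun_subspace B V \<and> fun_subspace A W \<and> bij_betw T (V \<times> UNIV) W \<and>
     (\<forall>\<phi> \<in> V. \<forall>\<psi> \<in> V. \<forall>c d. T (fun_add B \<phi> \<psi>, c + d) = fun_add A (T (\<phi>, c)) (T (\<psi>, d))) \<and>
     (\<forall>\<phi> \<in> V. \<forall>a c. T (fun_scale B a \<phi>, a * c) = fun_scale A a (T (\<phi>, c)))"

end

theory Submission
  imports Defs "HOL-Real_Asymp.Real_Asymp"
begin

text \<open>Let \<open>f\<close> be harmonic of linear growth and suppose that right translation by \<open>z\<close> commutes
  with all other right translations of \<open>f\<close>. Since \<open>z\<close> lies in the semigroup generated by the
  support of \<open>\<mu>\<close>, \<open>f\<close> is an average with an atom at \<open>z\<close>, so every linear bound on the \<open>n\<close>-fold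
  mean over \<open>x\<close>, \<open>xz\<close> transfers to \<open>f\<close> up to a drift of order \<open>n\<close>. Taking the difference in \<open>z\<close>
  of such a binomial mean gains a factor of order \<open>1 / sqrt n\<close>. Three differences beat the drift, so
  the third difference of \<open>f\<close> in \<open>z\<close> vanishes; linear growth along the powers of \<open>z\<close> then
  forces the first difference to be bounded. For bounded \<open>f\<close> a single difference already vanishes,
  which gives Liouville's theorem by descending the lower central series. Hence the first difference
  above is constant, and the quadratic distortion of commutators makes this constant zero for \<open>z\<close>
  in the commutator subgroup. So \<open>f\<close> descends to the abelianization, where all its differences are
  constant. Conversely, centering makes homomorphisms harmonic.\<close>

subsection \<open>Differences of binomial means\<close>

text \<open>For \<open>n\<close> fair signs of which \<open>i\<close> are negative,
  \<open>n - 2 * i\<close> is their sum, with variance \<open>n\<close>. The moments come from the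
  Bernstein identities at \<open>1/2\<close>.\<close>

lemma sum_choose_deviation_sq:
  "(\<Sum>i\<le>n. real (n choose i) * (real n - 2 * real i)\<^sup>2) = 2 ^ n * real n"
proof -
  have pw: "(1/2::real) ^ i * (1/2) ^ (n - i) = (1/2) ^ n" if "i \<le> n" for i
    using that by (simp flip: power_add)
  have B: "real (n choose i) = 2 ^ n * Bernstein n i (1/2)" if "i \<le> n" for i
    using pw[OF that] by (simp add: Bernstein_def power_one_over mult.assoc)
  have "(\<Sum>i\<le>n. real (n choose i) * (real n - 2 * real i)\<^sup>2)
      = (\<Sum>i\<le>n. 2 ^ n * ((real n)\<^sup>2 * Bernstein n i (1/2) + (4 - 4 * real n) * (real i * Bernstein n i (1/2))
          + 4 * (real i * (real i - 1) * Bernstein n i (1/2))))"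
    by (intro sum.cong refl) (simp add: B power2_eq_square algebra_simps)
  also have "\<dots> = 2 ^ n * ((real n)\<^sup>2 * (\<Sum>i\<le>n. Bernstein n i (1/2))
      + (4 - 4 * real n) * (\<Sum>i\<le>n. real i * Bernstein n i (1/2))
      + 4 * (\<Sum>i\<le>n. real i * (real i - 1) * Bernstein n i (1/2)))"
    by (simp only: sum.distrib flip: sum_distrib_left)
  also have "\<dots> = 2 ^ n * real n"
    unfolding sum_Bernstein sum_k_Bernstein sum_kk_Bernstein by (simp add: power2_eq_square field_simps)
  finally show ?thesis .
qed

text \<open>Cauchy-Schwarz with each weight split into two square roots: the first absolute moment
  is bounded by the root of the second.\<close>

lemma sum_choose_abs_deviation_le:
  "(\<Sum>i\<le>n. real (n choose i) * \<bar>real n - 2 * real i\<bar>) \<le> 2 ^ n * sqrt (real n)"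
proof -
  have "(\<Sum>i\<le>n. real (n choose i) * \<bar>real n - 2 * real i\<bar>)
      = (\<Sum>i\<le>n. sqrt (real (n choose i)) * (sqrt (real (n choose i)) * \<bar>real n - 2 * real i\<bar>))"
    by (intro sum.cong refl) (simp flip: mult.assoc)
  also have "\<dots> \<le> sqrt (\<Sum>i\<le>n. (sqrt (real (n choose i)))\<^sup>2)
      * sqrt (\<Sum>i\<le>n. (sqrt (real (n choose i)) * \<bar>real n - 2 * real i\<bar>)\<^sup>2)"
    using Cauchy_Schwarz_ineq_sum[of "\<lambda>i. sqrt (real (n choose i))"
        "\<lambda>i. sqrt (real (n choose i)) * \<bar>real n - 2 * real i\<bar>" "{..n}"]
    by (simp flip: real_sqrt_mult) (rule real_le_rsqrt)
  also have "\<dots> = sqrt (2 ^ n) * sqrt (2 ^ n * real n)"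
  proof -
    have "(\<Sum>i\<le>n. (sqrt (real (n choose i)))\<^sup>2) = 2 ^ n"
      using choose_row_sum[of n] by (simp flip: of_nat_sum)
    then show ?thesis
      using sum_choose_deviation_sq[of n] by (simp add: power_mult_distrib)
  qed
  also have "\<dots> = 2 ^ n * sqrt (real n)"
    by (simp add: real_sqrt_mult)
  finally show ?thesis .
qed

text \<open>Expresses the increments of binomial row \<open>n\<close> through row
  \<open>Suc n\<close> times the deviation, so that the first absolute moment controls their total
  variation.\<close>

lemma Suc_times_choose_diff:
  "real (Suc n) * (real (n choose Suc i) - real (n choose i))
    = real (Suc n choose Suc i) * (real (Suc n) - 2 * real (Suc i))"
proof -
  have 1: "real (Suc i) * real (Suc n choose Suc i) = real (Suc n) * real (n choose i)"
    using Suc_times_binomial_eq[of n i] by (simp only: mult.commute flip: of_nat_mult)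
  have 2: "real (Suc n choose Suc i) = real (n choose i) + real (n choose Suc i)"
    by simp
  have "real (Suc n choose Suc i) * (real (Suc n) - 2 * real (Suc i))
      = real (Suc n) * real (Suc n choose Suc i) - 2 * (real (Suc i) * real (Suc n choose Suc i))"
    by (simp add: algebra_simps)
  also have "\<dots> = real (Suc n) * (real (n choose Suc i) - real (n choose i))"
    unfolding 1 unfolding 2 by (simp only: algebra_simps)
  finally show ?thesis by simp
qed

text \<open>Summation by parts: the total variation of the binomial weights is of order \<open>1 / sqrt n\<close>.\<close>

lemma binomial_mean_diff_le:
  fixes y :: "nat \<Rightarrow> complex"
  assumes y: "\<And>i. i \<le> Suc n \<Longrightarrow> norm (y i) \<le> K"
  shows "norm (\<Sum>i\<le>n. of_nat (n choose i) / 2 ^ n * (y i - y (Suc i))) \<le> 2 / sqrt (real (Suc n)) * K"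
proof -
  \<comment> \<open>\<open>c i / Suc n\<close> is the coefficient of \<open>y i\<close> after
    summation by parts. It covers both ends, with value 1 at \<open>i = 0\<close> and -1 at
    \<open>i = Suc n\<close>, so no separate boundary term remains.\<close>
  define c where "c i = real (Suc n choose i) * (real (Suc n) - 2 * real i)" for i
  have parts: "(\<Sum>i\<le>n. of_nat (n choose i) * (y i - y (Suc i)))
      = (\<Sum>i\<le>Suc n. of_real (c i / real (Suc n)) * y i)"
  proof -
    \<comment> \<open>The first sum may run up to \<open>Suc n\<close> because
      \<open>n choose Suc n\<close> is 0.\<close>
    have "(\<Sum>i\<le>n. of_nat (n choose i) * (y i - y (Suc i)))
        = (\<Sum>i\<le>Suc n. of_nat (n choose i) * y i) - (\<Sum>i\<le>n. of_nat (n choose i) * y (Suc i))"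
      by (simp add: algebra_simps sum_subtractf)
    also have "\<dots> = y 0 + (\<Sum>i\<le>n. of_real (real (n choose Suc i) - real (n choose i)) * y (Suc i))"
      by (simp only: sum.atMost_Suc_shift) (simp add: algebra_simps sum_subtractf)
    also have "\<dots> = of_real (c 0 / real (Suc n)) * y 0
        + (\<Sum>i\<le>n. of_real (c (Suc i) / real (Suc n)) * y (Suc i))"
    proof -
      have "real (n choose Suc i) - real (n choose i) = c (Suc i) / real (Suc n)" for i
        using Suc_times_choose_diff[of n i] unfolding c_def
        by (simp add: field_simps del: of_nat_Suc binomial_Suc_Suc)
      moreover have "c 0 / real (Suc n) = 1"
        by (simp add: c_def)
      ultimately show ?thesis by simp
    qed
    also have "\<dots> = (\<Sum>i\<le>Suc n. of_real (c i / real (Suc n)) * y i)"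
      by (simp only: sum.atMost_Suc_shift)
    finally show ?thesis .
  qed
  have "K \<ge> 0"
    using y[of 0] norm_ge_zero[of "y 0"] by linarith
  have "norm (\<Sum>i\<le>n. of_nat (n choose i) * (y i - y (Suc i)))
      \<le> (\<Sum>i\<le>Suc n. \<bar>c i\<bar> / real (Suc n) * K)"
    unfolding parts
    by (intro sum_norm_le) (auto simp: norm_mult abs_mult norm_divide simp del: of_nat_Suc intro!: mult_mono divide_right_mono y)
  also have "\<dots> = (\<Sum>i\<le>Suc n. \<bar>c i\<bar>) * (K / real (Suc n))"
    by (simp only: sum_distrib_right) (simp add: field_simps)
  also have "\<dots> \<le> 2 ^ Suc n * sqrt (real (Suc n)) * (K / real (Suc n))"
    using sum_choose_abs_deviation_le[of "Suc n"] \<open>K \<ge> 0\<close>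
    by (intro mult_right_mono) (auto simp only: c_def abs_mult abs_of_nat intro!: divide_nonneg_nonneg)
  also have "\<dots> = 2 ^ n * (2 / sqrt (real (Suc n)) * K)"
    by (simp add: field_simps flip: real_sqrt_mult del: of_nat_Suc)
  finally have *: "norm (\<Sum>i\<le>n. of_nat (n choose i) * (y i - y (Suc i)))
      \<le> 2 ^ n * (2 / sqrt (real (Suc n)) * K)" .
  have "(\<Sum>i\<le>n. of_nat (n choose i) / 2 ^ n * (y i - y (Suc i)))
      = (\<Sum>i\<le>n. of_nat (n choose i) * (y i - y (Suc i))) / 2 ^ n"
    by (simp add: sum_divide_distrib)
  then show ?thesis
    using * by (simp add: norm_divide norm_power divide_le_eq mult.commute)
qed

lemma pascal_sum:
  fixes y :: "nat \<Rightarrow> complex"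
  shows "(\<Sum>i\<le>Suc n. of_nat (Suc n choose i) * y i)
    = (\<Sum>i\<le>n. of_nat (n choose i) * y i) + (\<Sum>i\<le>n. of_nat (n choose i) * y (Suc i))"
proof -
  have "(\<Sum>i\<le>n. of_nat (n choose i) * y i) = (\<Sum>i\<le>Suc n. of_nat (n choose i) * y i)"
    by simp
  also have "\<dots> = y 0 + (\<Sum>i\<le>n. of_nat (n choose Suc i) * y (Suc i))"
    by (simp only: sum.atMost_Suc_shift) simp
  finally show ?thesis
    by (simp only: sum.atMost_Suc_shift) (simp add: algebra_simps sum.distrib)
qed

section \<open>Absorbing lower-order terms in bounds that hold for every natural number\<close>

lemma le_of_linear_bound:
  fixes a P Q :: real
  assumes "\<And>k::nat. real k * a \<le> P + real k * Q"
  shows "a \<le> Q"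
proof (rule ccontr)
  assume "\<not> a \<le> Q"
  then obtain k :: nat where "P < real k * (a - Q)"
    using reals_Archimedean3[of "a - Q"] by auto
  with assms[of k] show False
    by (simp add: algebra_simps)
qed

lemma nonpos_of_quadratic_bound:
  fixes a P Q :: real
  assumes "P \<ge> 0" "Q \<ge> 0" "\<And>k::nat. (real k)\<^sup>2 * a \<le> P + real k * Q"
  shows "a \<le> 0"
proof (rule le_of_linear_bound)
  fix k :: nat
  show "real k * a \<le> (P + Q) + real k * 0"
  proof (cases k)
    case 0
    then show ?thesis using assms by simp
  next
    case (Suc j)
    then have "real k * (real k * a) \<le> P + real k * Q"
      using assms(3)[of k] by (simp add: power2_eq_square mult.assoc)
    also have "\<dots> \<le> real k * (P + Q)"
      using Suc \<open>P \<ge> 0\<close> by (simp add: algebra_simps)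
    finally show ?thesis
      using Suc by simp
  qed
qed

lemma nonpos_of_inverse_sqrt_bound:
  fixes a P :: real
  assumes "\<And>n::nat. a \<le> 2 / sqrt (real (Suc n)) * P"
  shows "a \<le> 0"
proof (rule LIMSEQ_le_const)
  show "(\<lambda>n. 2 / sqrt (real (Suc n)) * P) \<longlonglongrightarrow> 0"
    by real_asymp
qed (use assms in blast)

subsection \<open>Word length and linear growth\<close>

lemma (in group) foldr_append:
  assumes "set us \<subseteq> carrier G" "set vs \<subseteq> carrier G"
  shows "foldr (\<otimes>) us \<one> \<in> carrier G"
    and "foldr (\<otimes>) (us @ vs) \<one> = foldr (\<otimes>) us \<one> \<otimes> foldr (\<otimes>) vs \<one>"
proof -
  have *: "foldr (\<otimes>) ws \<one> \<in> carrier G" if "set ws \<subseteq> carrier G" for ws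
    using that by (induction ws) auto
  show "foldr (\<otimes>) us \<one> \<in> carrier G"
    using * assms(1) .
  show "foldr (\<otimes>) (us @ vs) \<one> = foldr (\<otimes>) us \<one> \<otimes> foldr (\<otimes>) vs \<one>"
    using assms(1)
  proof (induction us)
    case Nil
    then show ?case using *[OF assms(2)] by simp
  next
    case (Cons u us)
    then show ?case using *[of us] *[OF assms(2)] by (simp add: m_assoc)
  qed
qed

locale group_with_generators = group G for G (structure) +
  fixes S :: "'a set"
  assumes gen: "finite_symmetric_generating_set G S"
begin

abbreviation len :: "'a \<Rightarrow> real" where
  "len x \<equiv> real (word_length G S x)"

lemma S_carrier: "S \<subseteq> carrier G" and finite_S: "finite S"
  using gen by (auto simp: finite_symmetric_generating_set_def)

lemma ex_word:
  assumes "x \<in> carrier G"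
  shows "\<exists>ws. set ws \<subseteq> S \<and> foldr (\<otimes>) ws \<one> = x"
proof -
  have "x \<in> generate G S"
    using assms gen by (simp add: finite_symmetric_generating_set_def)
  then show ?thesis
  proof (induction rule: generate.induct)
    case one
    show ?case by (intro exI[of _ "[]"]) simp
  next
    case (incl h)
    then show ?case using S_carrier by (intro exI[of _ "[h]"]) auto
  next
    case (inv h)
    then have "inv h \<in> S" "inv h \<in> carrier G"
      using gen S_carrier by (auto simp: finite_symmetric_generating_set_def)
    then show ?case by (intro exI[of _ "[inv h]"]) auto
  next
    case (eng h1 h2)
    then obtain us vs where "set us \<subseteq> S" "foldr (\<otimes>) us \<one> = h1" "set vs \<subseteq> S" "foldr (\<otimes>) vs \<one> = h2"
      by blast
    then show ?case
      using foldr_append(2)[of us vs] S_carrier by (intro exI[of _ "us @ vs"]) auto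
  qed
qed

lemma ex_shortest_word:
  assumes "x \<in> carrier G"
  shows "\<exists>ws. length ws = word_length G S x \<and> set ws \<subseteq> S \<and> foldr (\<otimes>) ws \<one> = x"
  unfolding word_length_def by (rule LeastI_ex) (use ex_word[OF assms] in blast)

lemma word_length_le:
  assumes "set ws \<subseteq> S"
  shows "word_length G S (foldr (\<otimes>) ws \<one>) \<le> length ws"
  unfolding word_length_def by (rule Least_le) (use assms in blast)

lemma word_length_one: "word_length G S \<one> = 0"
  using word_length_le[of "[]"] by simp

lemma len_mult:
  assumes "x \<in> carrier G" "y \<in> carrier G"
  shows "len (x \<otimes> y) \<le> len x + len y"
proof -
  obtain us vs where uv: "length us = word_length G S x" "set us \<subseteq> S" "foldr (\<otimes>) us \<one> = x"
    "length vs = word_length G S y" "set vs \<subseteq> S" "foldr (\<otimes>) vs \<one> = y"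
    using ex_shortest_word[OF assms(1)] ex_shortest_word[OF assms(2)] by blast
  then have "foldr (\<otimes>) (us @ vs) \<one> = x \<otimes> y"
    using foldr_append(2)[of us vs] S_carrier by blast
  then have "word_length G S (x \<otimes> y) \<le> length (us @ vs)"
    using word_length_le[of "us @ vs"] uv by simp
  then show ?thesis using uv by simp
qed

lemma len_pow:
  assumes "x \<in> carrier G"
  shows "len (x [^] (n::nat)) \<le> real n * len x"
proof (induction n)
  case 0
  then show ?case by (simp add: word_length_one)
next
  case (Suc n)
  have "len (x [^] Suc n) \<le> len (x [^] n) + len x"
    using len_mult[of "x [^] n" x] assms by simp
  with Suc show ?case by (simp add: algebra_simps)
qed

lemma finite_balls: "finite {x \<in> carrier G. word_length G S x \<le> r}"
proof (rule finite_subset)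
  show "{x \<in> carrier G. word_length G S x \<le> r}
      \<subseteq> (\<lambda>ws. foldr (\<otimes>) ws \<one>) ` {ws. set ws \<subseteq> S \<and> length ws \<le> r}"
  proof
    fix x assume x: "x \<in> {x \<in> carrier G. word_length G S x \<le> r}"
    then obtain ws where "length ws = word_length G S x" "set ws \<subseteq> S" "foldr (\<otimes>) ws \<one> = x"
      using ex_shortest_word[of x] by auto
    with x show "x \<in> (\<lambda>ws. foldr (\<otimes>) ws \<one>) ` {ws. set ws \<subseteq> S \<and> length ws \<le> r}"
      by (intro image_eqI[of _ _ ws]) simp_all
  qed
  show "finite ((\<lambda>ws. foldr (\<otimes>) ws \<one>) ` {ws. set ws \<subseteq> S \<and> length ws \<le> r})"
    using finite_lists_length_le[OF finite_S] by simp
qed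

text \<open>Intercept and slope are kept apart because undoing means enlarges only the intercept.
  Slope \<open>B = 0\<close> means bounded.\<close>

definition lin_bounded :: "real \<Rightarrow> real \<Rightarrow> ('a \<Rightarrow> complex) \<Rightarrow> bool" where
  "lin_bounded A B f \<longleftrightarrow> 0 \<le> A \<and> 0 \<le> B \<and> (\<forall>x \<in> carrier G. norm (f x) \<le> A + B * len x)"

text \<open>Right translation by \<open>z\<close> commutes with all right translations on the orbit of \<open>f\<close>; this
  replaces passing to a quotient of \<open>G\<close> in which \<open>z\<close> is central.\<close>

definition commutes_with :: "'a \<Rightarrow> ('a \<Rightarrow> complex) \<Rightarrow> bool" where
  "commutes_with z f \<longleftrightarrow> (\<forall>x \<in> carrier G. \<forall>g \<in> carrier G. f (x \<otimes> g \<otimes> z) = f (x \<otimes> z \<otimes> g))"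

definition right_diff :: "'a \<Rightarrow> ('a \<Rightarrow> complex) \<Rightarrow> 'a \<Rightarrow> complex" where
  "right_diff z f x = f (x \<otimes> z) - f x"

definition right_mean :: "'a \<Rightarrow> ('a \<Rightarrow> complex) \<Rightarrow> 'a \<Rightarrow> complex" where
  "right_mean z f x = (f x + f (x \<otimes> z)) / 2"

text \<open>Commutation with \<open>g \<otimes> z\<close> in the role of \<open>g\<close>. This lets
  differences and means in \<open>z\<close> inherit \<open>commutes_with\<close>.\<close>

lemma commutes_with_translate:
  assumes "commutes_with z f" "x \<in> carrier G" "g \<in> carrier G" "z \<in> carrier G"
  shows "f (x \<otimes> g \<otimes> z \<otimes> z) = f (x \<otimes> z \<otimes> g \<otimes> z)"
proof -
  have "f (x \<otimes> (g \<otimes> z) \<otimes> z) = f (x \<otimes> z \<otimes> (g \<otimes> z))"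
    using assms unfolding commutes_with_def by blast
  with assms show ?thesis by (simp add: m_assoc)
qed

lemma commutes_with_right_diff:
  assumes "commutes_with z f" "z \<in> carrier G"
  shows "commutes_with z (right_diff z f)"
  unfolding commutes_with_def
proof (intro ballI)
  fix x g assume xg: "x \<in> carrier G" "g \<in> carrier G"
  have "f (x \<otimes> g \<otimes> z) = f (x \<otimes> z \<otimes> g)"
    using assms xg unfolding commutes_with_def by blast
  moreover have "f (x \<otimes> g \<otimes> z \<otimes> z) = f (x \<otimes> z \<otimes> g \<otimes> z)"
    using commutes_with_translate[OF assms(1) xg assms(2)] .
  moreover have "f (x \<otimes> z \<otimes> g \<otimes> z) = f (x \<otimes> z \<otimes> z \<otimes> g)"
    using assms xg unfolding commutes_with_def by (meson m_closed)
  ultimately show "right_diff z f (x \<otimes> g \<otimes> z) = right_diff z f (x \<otimes> z \<otimes> g)"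
    by (simp only: right_diff_def)
qed

lemma commutes_with_right_mean:
  assumes "commutes_with z f" "z \<in> carrier G"
  shows "commutes_with z (right_mean z f)"
  unfolding commutes_with_def
proof (intro ballI)
  fix x g assume xg: "x \<in> carrier G" "g \<in> carrier G"
  have "f (x \<otimes> g \<otimes> z) = f (x \<otimes> z \<otimes> g)"
    using assms xg unfolding commutes_with_def by blast
  moreover have "f (x \<otimes> g \<otimes> z \<otimes> z) = f (x \<otimes> z \<otimes> g \<otimes> z)"
    using commutes_with_translate[OF assms(1) xg assms(2)] .
  moreover have "f (x \<otimes> z \<otimes> g \<otimes> z) = f (x \<otimes> z \<otimes> z \<otimes> g)"
    using assms xg unfolding commutes_with_def by (meson m_closed)
  ultimately show "right_mean z f (x \<otimes> g \<otimes> z) = right_mean z f (x \<otimes> z \<otimes> g)"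
    by (simp only: right_mean_def)
qed

text \<open>Only translates by powers of \<open>z\<close> occur, so the iterates describe a lazy
  walk along these powers, and Pascal's rule gives its binomial weights.\<close>

lemma funpow_right_mean:
  assumes "x \<in> carrier G" "z \<in> carrier G"
  shows "(right_mean z ^^ n) f x = (\<Sum>i\<le>n. of_nat (n choose i) / 2 ^ n * f (x \<otimes> z [^] i))"
  using assms(1)
proof (induction n arbitrary: x)
  case 0
  then show ?case by simp
next
  case (Suc n)
  have shift: "x \<otimes> z \<otimes> z [^] i = x \<otimes> z [^] Suc i" for i
    using Suc.prems assms(2) nat_pow_Suc2[of z i] by (simp add: m_assoc)
  have IH: "(right_mean z ^^ n) f y = (\<Sum>i\<le>n. of_nat (n choose i) * f (y \<otimes> z [^] i)) / 2 ^ n"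
    if "y \<in> carrier G" for y
    unfolding Suc.IH[OF that] by (simp only: sum_divide_distrib times_divide_eq_left)
  have "(right_mean z ^^ Suc n) f x = ((right_mean z ^^ n) f x + (right_mean z ^^ n) f (x \<otimes> z)) / 2"
    by (simp add: right_mean_def)
  also have "\<dots> = ((\<Sum>i\<le>n. of_nat (n choose i) * f (x \<otimes> z [^] i))
        + (\<Sum>i\<le>n. of_nat (n choose i) * f (x \<otimes> z [^] Suc i))) / 2 ^ n / 2"
    unfolding IH[OF Suc.prems] IH[OF m_closed[OF Suc.prems assms(2)]] shift
    by (simp only: add_divide_distrib)
  also have "\<dots> = (\<Sum>i\<le>Suc n. of_nat (Suc n choose i) * f (x \<otimes> z [^] i)) / 2 ^ Suc n"
    unfolding pascal_sum power_Suc by (simp only: divide_divide_eq_left mult.commute)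
  also have "\<dots> = (\<Sum>i\<le>Suc n. of_nat (Suc n choose i) / 2 ^ Suc n * f (x \<otimes> z [^] i))"
    by (simp only: sum_divide_distrib times_divide_eq_left)
  finally show ?case .
qed

text \<open>The binomial mean of a difference is a sum of increments along the powers of
  \<open>z\<close>, so summation by parts gains the factor \<open>c\<close>. The points involved
  have length at most \<open>len x + Suc n * len z\<close>, which affects only the
  intercept.\<close>

lemma lin_bounded_mean_of_right_diff:
  fixes n :: nat
  assumes f: "lin_bounded A B f" and z: "z \<in> carrier G"
  defines "c \<equiv> 2 / sqrt (real (Suc n))"
  shows "lin_bounded (c * (A + B * (real (Suc n) * len z))) (c * B)
    ((right_mean z ^^ n) (right_diff z f))"
  unfolding lin_bounded_def
proof (intro conjI ballI)
  have nn: "0 \<le> A" "0 \<le> B" using f by (auto simp: lin_bounded_def)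
  then show "0 \<le> c * (A + B * (real (Suc n) * len z))" "0 \<le> c * B"
    by (simp_all add: c_def)
  have ring_split: "c * (A + B * (a + b)) = c * (A + B * b) + c * B * a" for a b
    by (simp add: algebra_simps)
  fix x assume x: "x \<in> carrier G"
  have bound: "norm (f (x \<otimes> z [^] i)) \<le> A + B * (len x + real (Suc n) * len z)" if "i \<le> Suc n" for i
  proof -
    have "len (x \<otimes> z [^] i) \<le> len x + real i * len z"
      using len_mult[of x "z [^] i"] len_pow[OF z, of i] x z by simp
    also have "\<dots> \<le> len x + real (Suc n) * len z"
      using that by (intro add_left_mono mult_right_mono) (simp_all only: of_nat_le_iff of_nat_0_le_iff)
    finally have "B * len (x \<otimes> z [^] i) \<le> B * (len x + real (Suc n) * len z)"
      using nn by (intro mult_left_mono)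
    moreover have "norm (f (x \<otimes> z [^] i)) \<le> A + B * len (x \<otimes> z [^] i)"
      using f x z unfolding lin_bounded_def by blast
    ultimately show ?thesis by linarith
  qed
  have "right_diff z f (x \<otimes> z [^] i) = - (f (x \<otimes> z [^] i) - f (x \<otimes> z [^] Suc i))" for i
    using x z by (simp add: right_diff_def m_assoc)
  then have "(right_mean z ^^ n) (right_diff z f) x
      = - (\<Sum>i\<le>n. of_nat (n choose i) / 2 ^ n * (f (x \<otimes> z [^] i) - f (x \<otimes> z [^] Suc i)))"
    by (simp only: funpow_right_mean[OF x z] mult_minus_right sum_negf)
  then have "norm ((right_mean z ^^ n) (right_diff z f) x)
      \<le> c * (A + B * (len x + real (Suc n) * len z))"
    using binomial_mean_diff_le[of n "\<lambda>i. f (x \<otimes> z [^] i)", OF bound]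
    by (simp only: c_def norm_minus_cancel)
  also have "\<dots> = c * (A + B * (real (Suc n) * len z)) + c * B * len x"
    by (rule ring_split)
  finally show "norm ((right_mean z ^^ n) (right_diff z f) x)
      \<le> c * (A + B * (real (Suc n) * len z)) + c * B * len x" .
qed

text \<open>Telescoping; it integrates a known difference along the powers of
  \<open>z\<close>.\<close>

lemma translate_pow_eq_sum:
  fixes h u :: "'a \<Rightarrow> complex"
  assumes "x \<in> carrier G" "z \<in> carrier G" "\<And>y. y \<in> carrier G \<Longrightarrow> h (y \<otimes> z) - h y = u y"
  shows "h (x \<otimes> z [^] (k::nat)) = h x + (\<Sum>i<k. u (x \<otimes> z [^] i))"
proof (induction k)
  case 0
  then show ?case using assms(1) by simp
next
  case (Suc k)
  have "h (x \<otimes> z [^] Suc k) = h (x \<otimes> z [^] k) + u (x \<otimes> z [^] k)"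
    using assms(1,2) assms(3)[of "x \<otimes> z [^] k"] by (simp add: m_assoc algebra_simps)
  with Suc show ?case by simp
qed

text \<open>A vanishing third difference makes \<open>f (x \<otimes> z [^] k)\<close> a quadratic
  polynomial in \<open>k\<close>. Linear growth kills its leading coefficient and bounds the slope
  that is left by \<open>B * len z\<close>, uniformly in \<open>x\<close>.\<close>

lemma right_diff_bounded_of_third_diff_zero:
  assumes f: "lin_bounded A B f" and z: "z \<in> carrier G"
    and zero: "\<And>x. x \<in> carrier G \<Longrightarrow> right_diff z (right_diff z (right_diff z f)) x = 0"
  shows "lin_bounded (B * len z) 0 (right_diff z f)"
proof -
  have nn: "0 \<le> A" "0 \<le> B" using f by (auto simp: lin_bounded_def)
  have "norm (right_diff z f x) \<le> B * len z" if x: "x \<in> carrier G" for x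
  proof -
    define d where "d = right_diff z f x"
    define u where "u = right_diff z (right_diff z f) x"
    have fk: "norm (f (x \<otimes> z [^] k)) \<le> A + B * len x + real k * (B * len z)" for k :: nat
    proof -
      have "B * len (x \<otimes> z [^] k) \<le> B * (len x + real k * len z)"
        using len_mult[of x "z [^] k"] len_pow[OF z, of k] x z nn by (intro mult_left_mono) auto
      moreover have "norm (f (x \<otimes> z [^] k)) \<le> A + B * len (x \<otimes> z [^] k)"
        using f x z unfolding lin_bounded_def by blast
      ultimately show ?thesis by (simp add: algebra_simps)
    qed
    have "right_diff z (right_diff z f) (x \<otimes> z [^] k) = u" for k :: nat
      using translate_pow_eq_sum[of x z "right_diff z (right_diff z f)" "\<lambda>_. 0" k] x z zero
      by (simp add: right_diff_def[of z "right_diff z (right_diff z f)"] u_def)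
    then have d1: "right_diff z f (x \<otimes> z [^] k) = d + of_nat k * u" for k :: nat
      using translate_pow_eq_sum[of x z "right_diff z f" "right_diff z (right_diff z f)" k] x z
      by (simp add: right_diff_def[of z "right_diff z f"] d_def)
    \<comment> \<open>Doubled to avoid the division in the triangular number
      \<open>k * (k - 1) / 2\<close>.\<close>
    have "2 * (\<Sum>i<k. d + of_nat i * u) = of_nat k * (2 * d) + (of_nat k * (of_nat k - 1)) * u" for k :: nat
      by (induction k) (simp_all add: algebra_simps)
    then have f2: "2 * (f (x \<otimes> z [^] k) - f x) = of_nat k * (2 * d) + (of_nat k * (of_nat k - 1)) * u" for k :: nat
      using translate_pow_eq_sum[of x z f "right_diff z f" k] x z d1
      by (simp add: right_diff_def[of z f])
    have f0: "norm (f x) \<le> A + B * len x"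
      using fk[of 0] x by simp
    have "norm u \<le> 0"
    proof (rule nonpos_of_quadratic_bound)
      fix k :: nat
      have "(of_nat k)\<^sup>2 * u = 2 * (f (x \<otimes> z [^] k) - f x) - of_nat k * (2 * d - u)"
        unfolding f2 by (simp add: power2_eq_square algebra_simps)
      then have "(real k)\<^sup>2 * norm u = norm (2 * (f (x \<otimes> z [^] k) - f x) - of_nat k * (2 * d - u))"
        by (metis norm_mult norm_of_nat norm_power)
      also have "\<dots> \<le> norm (2 * (f (x \<otimes> z [^] k) - f x)) + norm (of_nat k * (2 * d - u))"
        by (rule norm_triangle_ineq4)
      also have "\<dots> = 2 * norm (f (x \<otimes> z [^] k) - f x) + real k * norm (2 * d - u)"
        by (simp only: norm_mult norm_numeral norm_of_nat)
      also have "\<dots> \<le> 2 * (norm (f (x \<otimes> z [^] k)) + norm (f x)) + real k * norm (2 * d - u)"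
          by (intro add_right_mono mult_left_mono norm_triangle_ineq4) simp
      also have "\<dots> \<le> 4 * (A + B * len x) + real k * (2 * (B * len z) + norm (2 * d - u))"
        using fk[of k] f0 by (simp add: algebra_simps)
      finally show "(real k)\<^sup>2 * norm u \<le> 4 * (A + B * len x) + real k * (2 * (B * len z) + norm (2 * d - u))" .
    qed (use nn in auto)
    then have u0: "u = 0" by simp
    show "norm (right_diff z f x) \<le> B * len z"
    proof (rule le_of_linear_bound)
      fix k :: nat
      have "2 * (of_nat k * d) = 2 * (f (x \<otimes> z [^] k) - f x)"
        unfolding f2 by (simp add: u0)
      then have "of_nat k * d = f (x \<otimes> z [^] k) - f x"
        by (simp only: mult_cancel_left) simp
      then have "real k * norm d = norm (f (x \<otimes> z [^] k) - f x)"
        by (metis norm_mult norm_of_nat)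
      also have "\<dots> \<le> 2 * (A + B * len x) + real k * (B * len z)"
        using fk[of k] f0 norm_triangle_ineq4[of "f (x \<otimes> z [^] k)" "f x"] by argo
      finally show "real k * norm (right_diff z f x) \<le> 2 * (A + B * len x) + real k * (B * len z)"
        by (simp add: d_def)
    qed
  qed
  then show ?thesis
    using nn by (simp add: lin_bounded_def)
qed

end

subsection \<open>Harmonic functions of linear growth\<close>

text \<open>The first moment makes averages of linearly bounded functions converge and bounds the
  drift of one step.\<close>

locale random_walk = group_with_generators G S for G (structure) and S +
  fixes \<mu> :: "'a pmf"
  assumes supp: "set_pmf \<mu> \<subseteq> carrier G"
    and adapted: "adapted G \<mu>"
    and first_moment: "(\<lambda>g. pmf \<mu> g * len g) summable_on carrier G"
begin

lemma has_sum_pmf: "(pmf \<mu> has_sum 1) (carrier G)"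
proof -
  have "Infinite_Sum.abs_summable_on (pmf \<mu>) (carrier G)"
    using pmf_abs_summable abs_summable_equivalent by blast
  then have "pmf \<mu> summable_on carrier G"
    by (rule Infinite_Sum.abs_summable_summable)
  moreover have "infsum (pmf \<mu>) (carrier G) = 1"
    using infsetsum_infsum[OF pmf_abs_summable[of \<mu> "carrier G"]] infsetsum_pmf_eq_1[OF supp] by simp
  ultimately show ?thesis by (simp add: has_sum_iff)
qed

lemma abs_summable_translate:
  assumes f: "lin_bounded A B f" and x: "x \<in> carrier G"
  shows "(\<lambda>g. norm (complex_of_real (pmf \<mu> g) * f (x \<otimes> g))) summable_on carrier G"
proof (rule summable_on_comparison_test)
  show "(\<lambda>g. (A + B * len x) * pmf \<mu> g + B * (pmf \<mu> g * len g)) summable_on carrier G"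
    using has_sum_pmf first_moment by (intro summable_on_add summable_on_cmult_right) (auto simp: summable_on_def)
  fix g assume g: "g \<in> carrier G"
  have nn: "0 \<le> A" "0 \<le> B" and "norm (f (x \<otimes> g)) \<le> A + B * len (x \<otimes> g)"
    using f x g by (auto simp: lin_bounded_def)
  then have "norm (f (x \<otimes> g)) \<le> A + B * (len x + len g)"
    using mult_left_mono[OF len_mult[OF x g] \<open>0 \<le> B\<close>] by linarith
  then have "pmf \<mu> g * norm (f (x \<otimes> g)) \<le> pmf \<mu> g * (A + B * (len x + len g))"
    by (intro mult_left_mono) auto
  then show "norm (complex_of_real (pmf \<mu> g) * f (x \<otimes> g)) \<le> (A + B * len x) * pmf \<mu> g + B * (pmf \<mu> g * len g)"
    by (simp add: norm_mult algebra_simps)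
qed auto

text \<open>Removing the atom at \<open>z\<close> from the mean value property leaves mass
  \<open>1 - pmf \<mu> z\<close>. By subadditivity of the length, a step \<open>g\<close> raises the
  linear bound by at most \<open>B * len g\<close>, which sums to at most \<open>B\<close> times the
  first moment.\<close>

lemma harmonic_atom:
  assumes z: "z \<in> set_pmf \<mu>" and h: "harmonic G \<mu> h" and lin: "lin_bounded A B h" and x: "x \<in> carrier G"
  shows "norm (h x - of_real (pmf \<mu> z) * h (x \<otimes> z))
    \<le> (1 - pmf \<mu> z) * (A + B * len x) + B * (\<Sum>\<^sub>\<infinity>g \<in> carrier G. pmf \<mu> g * len g)"
proof -
  define \<phi> where "\<phi> g = complex_of_real (pmf \<mu> g) * h (x \<otimes> g)" for g
  define C where "C = carrier G - {z}"
  define m where "m = (\<Sum>\<^sub>\<infinity>g \<in> carrier G. pmf \<mu> g * len g)"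
  have zG: "z \<in> carrier G" using z supp by blast
  have abs: "(\<lambda>g. norm (\<phi> g)) summable_on carrier G"
    using abs_summable_translate[OF lin x] by (simp add: \<phi>_def)
  then have absC: "(\<lambda>g. norm (\<phi> g)) summable_on C"
    unfolding C_def by (rule summable_on_subset_banach) auto
  have "(\<phi> has_sum h x) (carrier G)"
    using h x abs_summable_summable[OF abs] unfolding harmonic_def \<phi>_def by (simp add: has_sum_iff)
  moreover have "(\<phi> has_sum \<phi> z) {z}"
    using has_sum_finite[of "{z}" \<phi>] by simp
  ultimately have "(\<phi> has_sum (h x - \<phi> z)) C"
    unfolding C_def using zG by (intro has_sum_Diff) auto
  then have "norm (h x - \<phi> z) \<le> (\<Sum>\<^sub>\<infinity>g\<in>C. norm (\<phi> g))"
    using norm_infsum_bound[OF absC] by (simp add: infsumI)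
  moreover have "(\<Sum>\<^sub>\<infinity>g\<in>C. norm (\<phi> g)) \<le> (A + B * len x) * (1 - pmf \<mu> z) + B * (m - pmf \<mu> z * len z)"
  proof (rule has_sum_mono)
    show "((\<lambda>g. norm (\<phi> g)) has_sum (\<Sum>\<^sub>\<infinity>g\<in>C. norm (\<phi> g))) C"
      using absC by simp
    have "(pmf \<mu> has_sum (1 - pmf \<mu> z)) C"
      unfolding C_def using has_sum_pmf has_sum_finite[of "{z}" "pmf \<mu>"] zG by (intro has_sum_Diff) auto
    moreover have "((\<lambda>g. pmf \<mu> g * len g) has_sum (m - pmf \<mu> z * len z)) C"
      unfolding C_def m_def using first_moment has_sum_finite[of "{z}" "\<lambda>g. pmf \<mu> g * len g"] zG
      by (intro has_sum_Diff) auto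
    ultimately show "((\<lambda>g. (A + B * len x) * pmf \<mu> g + B * (pmf \<mu> g * len g))
        has_sum (A + B * len x) * (1 - pmf \<mu> z) + B * (m - pmf \<mu> z * len z)) C"
      by (intro has_sum_add has_sum_cmult_right)
    fix g assume "g \<in> C"
    then have g: "g \<in> carrier G" by (simp add: C_def)
    have "0 \<le> B" and "norm (h (x \<otimes> g)) \<le> A + B * len (x \<otimes> g)"
      using lin x g by (auto simp: lin_bounded_def)
    then have "norm (h (x \<otimes> g)) \<le> A + B * (len x + len g)"
      using mult_left_mono[OF len_mult[OF x g] \<open>0 \<le> B\<close>] by linarith
    then have "pmf \<mu> g * norm (h (x \<otimes> g)) \<le> pmf \<mu> g * (A + B * (len x + len g))"
      by (intro mult_left_mono) auto
    then show "norm (\<phi> g) \<le> (A + B * len x) * pmf \<mu> g + B * (pmf \<mu> g * len g)"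
      by (simp add: \<phi>_def norm_mult algebra_simps)
  qed
  moreover have "0 \<le> B * (pmf \<mu> z * len z)"
    using lin by (auto simp: lin_bounded_def)
  ultimately show ?thesis
    by (simp add: \<phi>_def m_def algebra_simps)
qed

text \<open>Adaptedness writes \<open>z\<close> as a product of support elements. Under products the
  masses of the atoms multiply and the errors add up, with an extra \<open>len y\<close> for moving
  the base point from \<open>x\<close> to \<open>x \<otimes> y\<close>. The constants depend on
  \<open>z\<close> alone.\<close>

lemma harmonic_partial_average:
  assumes "z \<in> carrier G"
  obtains b m where "0 < b" "b \<le> 1" "0 \<le> m"
    "\<And>h A B x. \<lbrakk>harmonic G \<mu> h; lin_bounded A B h; x \<in> carrier G\<rbrakk> \<Longrightarrow>
      norm (h x - of_real b * h (x \<otimes> z)) \<le> (1 - b) * (A + B * len x) + B * m"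
proof -
  \<comment> \<open>The functions, their bounds and the base points are quantified inside
    \<open>P\<close>, so that the second factor can be applied at
    \<open>x \<otimes> y\<close>.\<close>
  define P where "P z b m \<longleftrightarrow> 0 < b \<and> b \<le> 1 \<and> 0 \<le> m \<and> (\<forall>h A B. \<forall>x \<in> carrier G.
    harmonic G \<mu> h \<longrightarrow> lin_bounded A B h \<longrightarrow>
      norm (h x - of_real b * h (x \<otimes> z)) \<le> (1 - b) * (A + B * len x) + B * m)" for z and b m :: real
  have "z \<in> semigroup_generated G (set_pmf \<mu>)"
    using assms adapted by (simp add: adapted_def)
  then have "z \<in> carrier G \<and> (\<exists>b m. P z b m)"
  proof (induction rule: semigroup_generated.induct)
    case (incl a)
    have "P a (pmf \<mu> a) (\<Sum>\<^sub>\<infinity>g \<in> carrier G. pmf \<mu> g * len g)"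
      unfolding P_def using harmonic_atom[OF incl]
      by (auto simp: pmf_positive[OF incl] pmf_le_1 intro: infsum_nonneg)
    then show ?case using incl supp by blast
  next
    case (mult y w)
    then obtain b m b' m' where y: "y \<in> carrier G" "P y b m" and w: "w \<in> carrier G" "P w b' m'"
      by blast
    have b: "0 < b" "b \<le> 1" "0 \<le> m" "0 < b'" "b' \<le> 1" "0 \<le> m'"
      using y w by (auto simp: P_def)
    have "P (y \<otimes> w) (b * b') (m + m' + len y)"
      unfolding P_def
    proof (intro conjI allI ballI impI)
      show "0 < b * b'" "b * b' \<le> 1" "0 \<le> m + m' + len y"
        using b by (auto simp: mult_le_one)
      fix h A B x
      assume x: "x \<in> carrier G" and h: "harmonic G \<mu> h" and lin: "lin_bounded A B h"
      have B: "0 \<le> B" using lin by (simp add: lin_bounded_def)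
      have xyw: "x \<otimes> (y \<otimes> w) = x \<otimes> y \<otimes> w" using x y w by (simp add: m_assoc)
      have 1: "norm (h x - of_real b * h (x \<otimes> y)) \<le> (1 - b) * (A + B * len x) + B * m"
        using y(2) x h lin unfolding P_def by blast
      have "norm (h (x \<otimes> y) - of_real b' * h (x \<otimes> y \<otimes> w)) \<le> (1 - b') * (A + B * len (x \<otimes> y)) + B * m'"
        using w(2) m_closed[OF x y(1)] h lin unfolding P_def by blast
      also have "\<dots> \<le> (1 - b') * (A + B * (len x + len y)) + B * m'"
        using b B len_mult[OF x y(1)] by (intro add_right_mono mult_left_mono add_left_mono) auto
      finally have 2: "b * norm (h (x \<otimes> y) - of_real b' * h (x \<otimes> y \<otimes> w))
          \<le> b * ((1 - b') * (A + B * (len x + len y)) + B * m')"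
        using b by (intro mult_left_mono) auto
      have "h x - of_real (b * b') * h (x \<otimes> (y \<otimes> w))
          = (h x - of_real b * h (x \<otimes> y)) + of_real b * (h (x \<otimes> y) - of_real b' * h (x \<otimes> y \<otimes> w))"
        by (simp add: xyw algebra_simps)
      then have "norm (h x - of_real (b * b') * h (x \<otimes> (y \<otimes> w)))
          \<le> norm (h x - of_real b * h (x \<otimes> y)) + b * norm (h (x \<otimes> y) - of_real b' * h (x \<otimes> y \<otimes> w))"
        using norm_triangle_ineq b by (metis abs_of_pos norm_mult norm_of_real)
      also have "\<dots> \<le> ((1 - b) * (A + B * len x) + B * m)
          + b * ((1 - b') * (A + B * (len x + len y)) + B * m')"
        using 1 2 by linarith
      also have "\<dots> = (1 - b * b') * (A + B * len x) + B * (m + b * m' + b * (1 - b') * len y)"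
        by (simp add: algebra_simps)
      also have "\<dots> \<le> (1 - b * b') * (A + B * len x) + B * (m + m' + len y)"
      proof -
        have "b * m' \<le> m'" "b * (1 - b') * len y \<le> len y"
          using b by (auto intro!: mult_left_le_one_le mult_le_one)
        then show ?thesis using B by (intro add_left_mono mult_left_mono) auto
      qed
      finally show "norm (h x - of_real (b * b') * h (x \<otimes> (y \<otimes> w)))
          \<le> (1 - b * b') * (A + B * len x) + B * (m + m' + len y)" .
    qed
    then show ?case using y w by blast
  qed
  then show ?thesis using that unfolding P_def by blast
qed

text \<open>Writing \<open>h x\<close> as \<open>b\<close> times its mean over \<open>x\<close>, \<open>xz\<close> plus a remainder of mass \<open>1 - b\<close>
  and iterating, any a priori linear bound on \<open>h\<close> is replaced by the one on the mean; the error
  after \<open>k\<close> rounds is \<open>K * q ^ k * (D + len x)\<close>.\<close>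

lemma lin_bounded_of_right_mean:
  assumes "z \<in> carrier G"
  obtains m where "0 \<le> m"
    "\<And>h A0 B0 A B. \<lbrakk>harmonic G \<mu> h; lin_bounded A0 B0 h; lin_bounded A B (right_mean z h)\<rbrakk> \<Longrightarrow>
      lin_bounded (A + B * m) B h"
proof -
  obtain b m where b: "0 < b" "b \<le> 1" and m: "0 \<le> m"
    and avg: "\<And>h A B x. \<lbrakk>harmonic G \<mu> h; lin_bounded A B h; x \<in> carrier G\<rbrakk> \<Longrightarrow>
      norm (h x - of_real b * h (x \<otimes> z)) \<le> (1 - b) * (A + B * len x) + B * m"
    by (rule harmonic_partial_average[OF assms]) blast
  \<comment> \<open>The error profile \<open>D + len x\<close> shrinks by the factor
    \<open>q\<close> in each round: \<open>b / 2 * D\<close> is at least \<open>m / 2\<close>, and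
    \<open>1 - b \<le> q\<close>.\<close>
  define D where "D = m / b + 1"
  define q where "q = 1 - b / 2"
  have D: "0 < D" "(1 - b) * D + m / 2 \<le> q * D"
    using b m by (simp_all add: D_def q_def field_simps)
  have q: "0 \<le> q" "q < 1" "1 - b \<le> q"
    using b by (simp_all add: q_def)
  have "lin_bounded (A + B * (m / (2 * b))) B h"
    if h: "harmonic G \<mu> h" and lin: "lin_bounded A0 B0 h" and mean: "lin_bounded A B (right_mean z h)"
    for h A0 B0 A B
  proof -
    have nn: "0 \<le> A" "0 \<le> B" "0 \<le> A0" "0 \<le> B0"
      using lin mean by (auto simp: lin_bounded_def)
    \<comment> \<open>Chosen so that the a priori bound \<open>A0 + B0 * len x\<close> is at most
      \<open>K * (D + len x)\<close>.\<close>
    define K where "K = B0 + A0 / D"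
    have K: "0 \<le> K" "B0 \<le> K" "A0 \<le> K * D"
      using nn D by (simp_all add: K_def field_simps)
    \<comment> \<open>The fixed point of the recursion that one round induces on the
      intercept.\<close>
    define A' where "A' = A + B * (m / (2 * b))"
    have A': "0 \<le> A'" "b * A + (1 - b) * A' + B * m / 2 = A'"
      using nn b m by (simp_all add: A'_def field_simps)
    have bounds: "lin_bounded (A' + K * q ^ k * D) (B + K * q ^ k) h" for k
    proof (induction k)
      case 0
      show ?case
        unfolding lin_bounded_def
      proof (intro conjI ballI)
        fix x assume "x \<in> carrier G"
        then have "norm (h x) \<le> A0 + B0 * len x"
          using lin by (simp add: lin_bounded_def)
        also have "\<dots> \<le> (A' + K * q ^ 0 * D) + (B + K * q ^ 0) * len x"
          using K nn A' by (intro add_mono mult_right_mono) auto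
        finally show "norm (h x) \<le> (A' + K * q ^ 0 * D) + (B + K * q ^ 0) * len x" .
      qed (use K nn A' D in auto)
    next
      case (Suc k)
      define E where "E = K * q ^ k"
      have E: "0 \<le> E" "lin_bounded (A' + E * D) (B + E) h"
        using K q Suc by (simp_all add: E_def)
      have "norm (h x) \<le> (A' + E * q * D) + (B + E * q) * len x" if x: "x \<in> carrier G" for x
      proof -
        have r: "norm (h x - of_real b * h (x \<otimes> z)) \<le> (1 - b) * ((A' + E * D) + (B + E) * len x) + (B + E) * m"
          using avg[OF h E(2) x] .
        have h0: "norm (h x) \<le> (A' + E * D) + (B + E) * len x"
          using E x by (simp add: lin_bounded_def)
        have mn: "norm (right_mean z h x) \<le> A + B * len x"
          using mean x by (simp add: lin_bounded_def)
        \<comment> \<open>Half of \<open>h x\<close> is kept and half is averaged with its atom at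
          \<open>x \<otimes> z\<close> split off. Mass \<open>b / 2\<close> from each half forms
          \<open>b\<close> times the mean; mass \<open>1 - b\<close> remains for the inductive
          bound.\<close>
        have "h x = of_real b * right_mean z h x + of_real ((1 - b) / 2) * h x
            + of_real (1 / 2) * (h x - of_real b * h (x \<otimes> z))"
          by (simp add: right_mean_def field_simps)
        then have "norm (h x) = norm (of_real b * right_mean z h x + of_real ((1 - b) / 2) * h x
            + of_real (1 / 2) * (h x - of_real b * h (x \<otimes> z)))"
          by (rule arg_cong)
        also have "\<dots> \<le> norm (of_real b * right_mean z h x) + norm (of_real ((1 - b) / 2) * h x)
            + norm (of_real (1 / 2) * (h x - of_real b * h (x \<otimes> z)))"
          by (intro norm_triangle_le add_mono norm_triangle_ineq order_refl)
        also have "\<dots> = b * norm (right_mean z h x) + (1 - b) / 2 * norm (h x)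
            + 1 / 2 * norm (h x - of_real b * h (x \<otimes> z))"
          using b by (simp only: norm_mult norm_of_real) simp
        also have "\<dots> \<le> b * (A + B * len x) + (1 - b) / 2 * ((A' + E * D) + (B + E) * len x)
            + 1 / 2 * ((1 - b) * ((A' + E * D) + (B + E) * len x) + (B + E) * m)"
          using r h0 mn b by (intro add_mono mult_left_mono) auto
        also have "\<dots> = (b * A + (1 - b) * A' + B * m / 2) + B * len x
            + E * (((1 - b) * D + m / 2) + (1 - b) * len x)"
          by (simp add: field_simps)
        also have "\<dots> \<le> A' + B * len x + E * (q * D + q * len x)"
          unfolding A'(2) using E D q by (intro add_left_mono mult_left_mono add_mono mult_right_mono) auto
        also have "\<dots> = (A' + E * q * D) + (B + E * q) * len x"
          by (simp add: algebra_simps)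
        finally show ?thesis .
      qed
      moreover have "K * q ^ Suc k = E * q" by (simp add: E_def)
      ultimately show ?case
        using E nn A' q D by (simp only: lin_bounded_def) simp
    qed
    have "norm (h x) \<le> A' + B * len x" if x: "x \<in> carrier G" for x
    proof (rule LIMSEQ_le_const)
      have "(\<lambda>k. q ^ k) \<longlonglongrightarrow> 0"
        using q by (simp add: LIMSEQ_power_zero)
      then have "(\<lambda>k. (A' + K * q ^ k * D) + (B + K * q ^ k) * len x)
          \<longlonglongrightarrow> (A' + K * 0 * D) + (B + K * 0) * len x"
        by (intro tendsto_add tendsto_mult tendsto_const)
      then show "(\<lambda>k. (A' + K * q ^ k * D) + (B + K * q ^ k) * len x) \<longlonglongrightarrow> A' + B * len x"
        by simp
      show "\<exists>N. \<forall>k\<ge>N. norm (h x) \<le> (A' + K * q ^ k * D) + (B + K * q ^ k) * len x"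
        using bounds x by (simp add: lin_bounded_def)
    qed
    then show ?thesis
      using A' nn by (simp add: lin_bounded_def A'_def)
  qed
  then show ?thesis
    using that[of "m / (2 * b)"] b m by simp
qed

text \<open>The mean value property at \<open>k \<otimes> z\<close> becomes that of the translate
  once \<open>z\<close> is moved past the step \<open>g\<close>, which \<open>commutes_with\<close>
  permits.\<close>

lemma harmonic_right_translate:
  assumes h: "harmonic G \<mu> h" and c: "commutes_with z h" and z: "z \<in> carrier G"
  shows "harmonic G \<mu> (\<lambda>x. h (x \<otimes> z))"
  unfolding harmonic_def
proof (intro ballI)
  fix k assume k: "k \<in> carrier G"
  have eq: "complex_of_real (pmf \<mu> g) * h (k \<otimes> g \<otimes> z) = complex_of_real (pmf \<mu> g) * h (k \<otimes> z \<otimes> g)"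
    if "g \<in> carrier G" for g
    using c k that unfolding commutes_with_def by simp
  have "(\<lambda>g. norm (complex_of_real (pmf \<mu> g) * h (k \<otimes> z \<otimes> g))) summable_on carrier G \<and>
      h (k \<otimes> z) = (\<Sum>\<^sub>\<infinity>g \<in> carrier G. complex_of_real (pmf \<mu> g) * h (k \<otimes> z \<otimes> g))"
    using h k z unfolding harmonic_def by (meson m_closed)
  moreover have "(\<lambda>g. norm (complex_of_real (pmf \<mu> g) * h (k \<otimes> g \<otimes> z))) summable_on carrier G
      \<longleftrightarrow> (\<lambda>g. norm (complex_of_real (pmf \<mu> g) * h (k \<otimes> z \<otimes> g))) summable_on carrier G"
    by (rule summable_on_cong) (simp only: eq)
  moreover have "(\<Sum>\<^sub>\<infinity>g \<in> carrier G. complex_of_real (pmf \<mu> g) * h (k \<otimes> g \<otimes> z))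
      = (\<Sum>\<^sub>\<infinity>g \<in> carrier G. complex_of_real (pmf \<mu> g) * h (k \<otimes> z \<otimes> g))"
    by (rule infsum_cong) (simp only: eq)
  ultimately show "(\<lambda>g. norm (complex_of_real (pmf \<mu> g) * h (k \<otimes> g \<otimes> z))) summable_on carrier G \<and>
      h (k \<otimes> z) = (\<Sum>\<^sub>\<infinity>g \<in> carrier G. complex_of_real (pmf \<mu> g) * h (k \<otimes> g \<otimes> z))"
    by (simp only:)
qed

lemma harmonic_lincomb:
  assumes "harmonic G \<mu> f" "harmonic G \<mu> h"
  shows "harmonic G \<mu> (\<lambda>x. a * f x + b * h x)"
  unfolding harmonic_def
proof (intro ballI)
  fix k assume k: "k \<in> carrier G"
  let ?f = "\<lambda>g. complex_of_real (pmf \<mu> g) * f (k \<otimes> g)"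
  let ?h = "\<lambda>g. complex_of_real (pmf \<mu> g) * h (k \<otimes> g)"
  have f: "(\<lambda>g. norm (?f g)) summable_on carrier G" "f k = infsum ?f (carrier G)"
    and h: "(\<lambda>g. norm (?h g)) summable_on carrier G" "h k = infsum ?h (carrier G)"
    using assms k unfolding harmonic_def by blast+
  have split: "complex_of_real (pmf \<mu> g) * (a * f (k \<otimes> g) + b * h (k \<otimes> g)) = a * ?f g + b * ?h g" for g
    by (simp add: algebra_simps)
  have "(\<lambda>g. norm (a * ?f g + b * ?h g)) summable_on carrier G"
  proof (rule summable_on_comparison_test)
    show "(\<lambda>g. norm a * norm (?f g) + norm b * norm (?h g)) summable_on carrier G"
      using f h by (intro summable_on_add summable_on_cmult_right)
    show "norm (a * ?f g + b * ?h g) \<le> norm a * norm (?f g) + norm b * norm (?h g)" for g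
      by (metis norm_mult norm_triangle_ineq)
  qed auto
  moreover have "((\<lambda>g. a * ?f g + b * ?h g) has_sum (a * f k + b * h k)) (carrier G)"
    using abs_summable_summable[OF f(1)] abs_summable_summable[OF h(1)] f(2) h(2)
    by (intro has_sum_add has_sum_cmult_right) (simp_all add: has_sum_iff)
  ultimately show "(\<lambda>g. norm (complex_of_real (pmf \<mu> g) * (a * f (k \<otimes> g) + b * h (k \<otimes> g)))) summable_on carrier G \<and>
      a * f k + b * h k = (\<Sum>\<^sub>\<infinity>g\<in>carrier G. complex_of_real (pmf \<mu> g) * (a * f (k \<otimes> g) + b * h (k \<otimes> g)))"
    unfolding split by (simp add: infsumI)
qed

lemma harmonic_right_diff:
  assumes "harmonic G \<mu> h" "commutes_with z h" "z \<in> carrier G"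
  shows "harmonic G \<mu> (right_diff z h)"
  using harmonic_lincomb[OF harmonic_right_translate[OF assms] assms(1), of 1 "-1"]
  by (simp add: right_diff_def[abs_def])

lemma harmonic_right_mean:
  assumes "harmonic G \<mu> h" "commutes_with z h" "z \<in> carrier G"
  shows "harmonic G \<mu> (right_mean z h)"
  using harmonic_lincomb[OF harmonic_right_translate[OF assms] assms(1), of "1/2" "1/2"]
  by (simp add: right_mean_def[abs_def] add_divide_distrib add.commute)

text \<open>The \<open>n\<close> means are undone one at a time; each costs \<open>B * m\<close> in
  the intercept and nothing in the slope.\<close>

lemma lin_bounded_of_iterated_right_mean:
  assumes z: "z \<in> carrier G"
  obtains m where "0 \<le> m"
    "\<And>n h A0 B0 A B. \<lbrakk>harmonic G \<mu> h; commutes_with z h; lin_bounded A0 B0 h;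
        lin_bounded A B ((right_mean z ^^ n) h)\<rbrakk> \<Longrightarrow> lin_bounded (A + real n * (B * m)) B h"
proof -
  obtain m where m: "0 \<le> m"
    and mean: "\<And>h A0 B0 A B. \<lbrakk>harmonic G \<mu> h; lin_bounded A0 B0 h; lin_bounded A B (right_mean z h)\<rbrakk> \<Longrightarrow>
      lin_bounded (A + B * m) B h"
    by (rule lin_bounded_of_right_mean[OF z]) blast
  \<comment> \<open>Every intermediate mean must have some a priori linear bound; its constants do
    not enter the result.\<close>
  have lin: "\<exists>A B. lin_bounded A B (right_mean z h)" if h: "lin_bounded A0 B0 h" for h A0 B0
  proof -
    have "lin_bounded (A0 + B0 * len z) B0 (right_mean z h)"
      unfolding lin_bounded_def
    proof (intro conjI ballI)
      have nn: "0 \<le> A0" "0 \<le> B0" using h by (auto simp: lin_bounded_def)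
      then show "0 \<le> A0 + B0 * len z" "0 \<le> B0" by auto
      fix x assume x: "x \<in> carrier G"
      have "norm (h x) \<le> A0 + B0 * len x" "norm (h (x \<otimes> z)) \<le> A0 + B0 * len (x \<otimes> z)"
        using h x z by (auto simp: lin_bounded_def)
      moreover have "B0 * len (x \<otimes> z) \<le> B0 * len x + B0 * len z"
        using mult_left_mono[OF len_mult[OF x z] nn(2)] by (simp add: algebra_simps)
      moreover have "0 \<le> B0 * len z" using nn by simp
      moreover have "norm (right_mean z h x) \<le> (norm (h x) + norm (h (x \<otimes> z))) / 2"
        by (simp add: right_mean_def norm_divide norm_triangle_ineq)
      ultimately show "norm (right_mean z h x) \<le> (A0 + B0 * len z) + B0 * len x"
        by argo
    qed
    then show ?thesis by blast
  qed
  have "lin_bounded (A + real n * (B * m)) B h"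
    if "harmonic G \<mu> h" "commutes_with z h" "lin_bounded A0 B0 h" "lin_bounded A B ((right_mean z ^^ n) h)"
    for n h A0 B0 A B
    using that
  proof (induction n arbitrary: h A0 B0)
    case 0
    then show ?case by simp
  next
    case (Suc n)
    obtain A1 B1 where "lin_bounded A1 B1 (right_mean z h)"
      using lin Suc.prems(3) by blast
    then have "lin_bounded (A + real n * (B * m)) B (right_mean z h)"
      using Suc.IH[of "right_mean z h"] Suc.prems harmonic_right_mean commutes_with_right_mean z
      by (simp add: funpow_swap1)
    then have "lin_bounded (A + real n * (B * m) + B * m) B h"
      using mean Suc.prems by blast
    then show ?case by (simp add: algebra_simps)
  qed
  with m show ?thesis using that by blast
qed

text \<open>Averaging the difference gains \<open>2 / sqrt (Suc n)\<close>. Undoing the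
  \<open>n\<close> means adds a drift proportional to the new slope, so the drift carries the same
  factor. \<open>\<kappa>\<close> collects \<open>len z\<close> and the cost of one mean.\<close>

lemma right_diff_decay:
  assumes z: "z \<in> carrier G"
  obtains \<kappa> where "0 \<le> \<kappa>"
    "\<And>n f A B. \<lbrakk>harmonic G \<mu> f; commutes_with z f; lin_bounded A B f\<rbrakk> \<Longrightarrow>
      lin_bounded (2 / sqrt (real (Suc n)) * (A + B * (real (Suc n) * \<kappa>))) (2 / sqrt (real (Suc n)) * B)
        (right_diff z f)"
proof -
  obtain m where m: "0 \<le> m"
    and it: "\<And>n h A0 B0 A B. \<lbrakk>harmonic G \<mu> h; commutes_with z h; lin_bounded A0 B0 h;
        lin_bounded A B ((right_mean z ^^ n) h)\<rbrakk> \<Longrightarrow> lin_bounded (A + real n * (B * m)) B h"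
    by (rule lin_bounded_of_iterated_right_mean[OF z]) blast
  have "lin_bounded (2 / sqrt (real (Suc n)) * (A + B * (real (Suc n) * (len z + m)))) (2 / sqrt (real (Suc n)) * B)
        (right_diff z f)"
    if f: "harmonic G \<mu> f" "commutes_with z f" "lin_bounded A B f" for n f A B
  proof -
    define c where "c = 2 / sqrt (real (Suc n))"
    have nn: "0 \<le> A" "0 \<le> B" "0 \<le> c" using f by (auto simp: lin_bounded_def c_def)
    have mean: "lin_bounded (c * (A + B * (real (Suc k) * len z))) (c * B)
        ((right_mean z ^^ k) (right_diff z f))" if "c = 2 / sqrt (real (Suc k))" for c and k
      using lin_bounded_mean_of_right_diff[OF f(3) z, of k] that by simp
    \<comment> \<open>The zeroth iterated mean is the difference itself, which yields the a priori
      bound.\<close>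
    obtain A0 B0 where "lin_bounded A0 B0 (right_diff z f)"
      using mean[OF refl, of 0] by auto
    then have "lin_bounded (c * (A + B * (real (Suc n) * len z)) + real n * (c * B * m)) (c * B) (right_diff z f)"
      using it mean[OF c_def] harmonic_right_diff[OF f(1,2) z] commutes_with_right_diff[OF f(2) z] by blast
    moreover have "c * (A + B * (real (Suc n) * len z)) + real n * (c * B * m)
        \<le> c * (A + B * (real (Suc n) * (len z + m)))"
      using nn m by (simp add: algebra_simps)
    ultimately have "lin_bounded (c * (A + B * (real (Suc n) * (len z + m)))) (c * B) (right_diff z f)"
      unfolding lin_bounded_def by (fastforce intro: order_trans)
    then show ?thesis by (simp only: c_def)
  qed
  then show ?thesis using that[of "len z + m"] m by simp
qed

text \<open>With slope 0 there is no drift, and the bound on one difference tends to 0 as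
  \<open>n\<close> grows.\<close>

lemma bounded_harmonic_right_diff_zero:
  assumes f: "harmonic G \<mu> f" "commutes_with z f" "lin_bounded A 0 f"
    and z: "z \<in> carrier G" and x: "x \<in> carrier G"
  shows "f (x \<otimes> z) = f x"
proof -
  obtain \<kappa> where decay: "\<And>n f A B. \<lbrakk>harmonic G \<mu> f; commutes_with z f; lin_bounded A B f\<rbrakk> \<Longrightarrow>
      lin_bounded (2 / sqrt (real (Suc n)) * (A + B * (real (Suc n) * \<kappa>))) (2 / sqrt (real (Suc n)) * B)
        (right_diff z f)"
    by (rule right_diff_decay[OF z]) blast
  have "norm (right_diff z f x) \<le> 0"
  proof (rule nonpos_of_inverse_sqrt_bound)
    show "norm (right_diff z f x) \<le> 2 / sqrt (real (Suc n)) * A" for n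
      using decay[OF f, of n] x by (simp add: lin_bounded_def)
  qed
  then show ?thesis by (simp add: right_diff_def)
qed

text \<open>Three differences gain a factor of order \<open>n powr (-3/2)\<close>, which beats the drift of order \<open>n\<close>.\<close>

lemma harmonic_third_diff_zero:
  assumes f: "harmonic G \<mu> f" "commutes_with z f" "lin_bounded A B f"
    and z: "z \<in> carrier G" and x: "x \<in> carrier G"
  shows "right_diff z (right_diff z (right_diff z f)) x = 0"
proof -
  obtain \<kappa> where \<kappa>: "0 \<le> \<kappa>" and decay: "\<And>n f A B. \<lbrakk>harmonic G \<mu> f; commutes_with z f; lin_bounded A B f\<rbrakk> \<Longrightarrow>
      lin_bounded (2 / sqrt (real (Suc n)) * (A + B * (real (Suc n) * \<kappa>))) (2 / sqrt (real (Suc n)) * B)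
        (right_diff z f)"
    by (rule right_diff_decay[OF z]) blast
  note cl = harmonic_right_diff[OF _ _ z] commutes_with_right_diff[OF _ z]
  have nn: "0 \<le> A" "0 \<le> B" using f by (auto simp: lin_bounded_def)
  have "norm (right_diff z (right_diff z (right_diff z f)) x) \<le> 0"
  proof (rule nonpos_of_inverse_sqrt_bound)
    fix n :: nat
    define N where "N = real (Suc n)"
    define c where "c = 2 / sqrt N"
    have N: "1 \<le> N" by (simp add: N_def)
    have cc: "c * c = 4 / N" and c: "0 \<le> c" using N by (simp_all add: c_def)
    note dec = decay[of _ _ _ n, folded N_def, folded c_def]
    have "lin_bounded (c * (A + B * (N * \<kappa>))) (c * B) (right_diff z f)"
      using dec f by blast
    then have "lin_bounded (c * (c * (A + B * (N * \<kappa>)) + c * B * (N * \<kappa>))) (c * (c * B))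
        (right_diff z (right_diff z f))"
      using dec f cl by blast
    then have "lin_bounded (c * (c * (c * (A + B * (N * \<kappa>)) + c * B * (N * \<kappa>)) + c * (c * B) * (N * \<kappa>)))
        (c * (c * (c * B))) (right_diff z (right_diff z (right_diff z f)))"
      using dec f cl by blast
    then have "norm (right_diff z (right_diff z (right_diff z f)) x)
        \<le> c * (c * (c * (A + B * (N * \<kappa>)) + c * B * (N * \<kappa>)) + c * (c * B) * (N * \<kappa>))
          + c * (c * (c * B)) * len x"
      using x by (simp add: lin_bounded_def)
    \<comment> \<open>Each of the three differences contributes one drift term, whence the
      coefficient 3.\<close>
    also have "\<dots> = c * ((c * c) * (A + 3 * B * (N * \<kappa>) + B * len x))"
      by (simp add: algebra_simps)
    \<comment> \<open>Inflating the remaining terms by \<open>N \<ge> 1\<close> lets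
      \<open>c * c = 4 / N\<close> cancel the drift; one factor \<open>c\<close> survives and tends
      to 0.\<close>
    also have "\<dots> \<le> c * ((c * c) * (N * (A + 3 * B * \<kappa> + B * len x)))"
    proof -
      have "1 * (A + B * len x) \<le> N * (A + B * len x)"
        using N nn by (intro mult_right_mono) auto
      then show ?thesis
        using c by (intro mult_left_mono) (auto simp: algebra_simps)
    qed
    also have "\<dots> = c * (4 * (A + 3 * B * \<kappa> + B * len x))"
      unfolding cc using N by simp
    finally show "norm (right_diff z (right_diff z (right_diff z f)) x)
        \<le> 2 / sqrt (real (Suc n)) * (4 * (A + 3 * B * \<kappa> + B * len x))"
      by (simp only: c_def N_def)
  qed
  then show ?thesis by simp
qed

lemma bounded_right_diff:
  assumes "harmonic G \<mu> f" "commutes_with z f" "lin_bounded A B f" "z \<in> carrier G"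
  shows "lin_bounded (B * len z) 0 (right_diff z f)"
  using right_diff_bounded_of_third_diff_zero[OF assms(3,4)] harmonic_third_diff_zero[OF assms] by blast

end

subsection \<open>Descent along the lower central series\<close>

definition (in group) invariant_under :: "'a set \<Rightarrow> ('a \<Rightarrow> complex) \<Rightarrow> bool" where
  "invariant_under N f \<longleftrightarrow> (\<forall>x \<in> carrier G. \<forall>z \<in> N. f (x \<otimes> z) = f x)"

lemma (in group) invariant_under_generate:
  assumes N: "N \<subseteq> carrier G" and inv: "invariant_under N f"
  shows "invariant_under (generate G N) f"
proof -
  have "z \<in> carrier G \<and> (\<forall>x \<in> carrier G. f (x \<otimes> z) = f x)" if "z \<in> generate G N" for z
    using that
  proof (induction rule: generate.induct)
    case one
    then show ?case by simp
  next
    case (incl h)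
    then show ?case using inv N by (auto simp: invariant_under_def)
  next
    case (inv h)
    then have h: "h \<in> carrier G" using N by blast
    have "f (x \<otimes> inv h) = f x" if x: "x \<in> carrier G" for x
    proof -
      have "f (x \<otimes> inv h \<otimes> h) = f (x \<otimes> inv h)"
        using assms(2) inv x h unfolding invariant_under_def by blast
      then show ?thesis using x h by (simp add: m_assoc)
    qed
    then show ?case using h by blast
  next
    case (eng a b)
    then show ?case by (simp flip: m_assoc)
  qed
  then show ?thesis by (simp add: invariant_under_def)
qed

lemma (in group) subgroup_lower_central: "subgroup (lower_central G n) G"
proof (induction n)
  case 0
  then show ?case by (simp add: subgroup_self)
next
  case (Suc n)
  then have "lower_central G n \<subseteq> carrier G" by (rule subgroup.subset)
  then show ?case
    unfolding lower_central.simps by (intro generate_is_subgroup) auto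
qed

lemma (in group) commutator_in_lower_central:
  assumes "x \<in> lower_central G n" "y \<in> carrier G"
  shows "x \<otimes> y \<otimes> inv x \<otimes> inv y \<in> lower_central G (Suc n)"
  unfolding lower_central.simps by (rule generate.incl) (use assms in blast)

lemma (in group) mult_inv_cancel:
  assumes "x \<in> carrier G" "y \<in> carrier G"
  shows "inv x \<otimes> (x \<otimes> y) = y" "x \<otimes> (inv x \<otimes> y) = y"
  using assms by (simp_all flip: m_assoc)

text \<open>\<open>z \<otimes> g\<close> is \<open>g \<otimes> z\<close> times a commutator of
  \<open>inv z\<close> and \<open>inv g\<close>. It is placed on the right, where invariance under
  the next term of the series removes it.\<close>

lemma (in group_with_generators) commutes_with_of_invariant:
  assumes inv: "invariant_under (lower_central G (Suc n)) f" and z: "z \<in> lower_central G n"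
  shows "commutes_with z f"
  unfolding commutes_with_def
proof (intro ballI)
  fix x g assume x: "x \<in> carrier G" and g: "g \<in> carrier G"
  have zG: "z \<in> carrier G" and "inv z \<in> lower_central G n"
    using subgroup_lower_central z by (blast intro: subgroup.mem_carrier subgroup.m_inv_closed)+
  then have comm: "inv z \<otimes> inv g \<otimes> z \<otimes> g \<in> lower_central G (Suc n)"
    using commutator_in_lower_central[of "inv z" n "inv g"] g by simp
  have "g \<otimes> z \<otimes> (inv z \<otimes> inv g \<otimes> z \<otimes> g) = z \<otimes> g"
    using zG g by (simp add: m_assoc mult_inv_cancel)
  then have "x \<otimes> g \<otimes> z \<otimes> (inv z \<otimes> inv g \<otimes> z \<otimes> g) = x \<otimes> z \<otimes> g"
    using x zG g by (simp add: m_assoc)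
  moreover have "f (x \<otimes> g \<otimes> z \<otimes> (inv z \<otimes> inv g \<otimes> z \<otimes> g)) = f (x \<otimes> g \<otimes> z)"
    using inv comm x g zG unfolding invariant_under_def by blast
  ultimately show "f (x \<otimes> g \<otimes> z) = f (x \<otimes> z \<otimes> g)" by simp
qed

locale nilpotent_random_walk = random_walk +
  assumes nilpotent: "nilpotent_group G"
begin

lemma invariant_under_one: "invariant_under {\<one>} f"
  by (simp add: invariant_under_def)

text \<open>Invariance under one term of the lower central series makes elements of the preceding
  term commute with \<open>f\<close>, and boundedness then gives invariance under that term too. The
  induction climbs from the trivial term to the whole group.\<close>

lemma liouville:
  assumes f: "harmonic G \<mu> f" "lin_bounded A 0 f" and x: "x \<in> carrier G"
  shows "f x = f \<one>"
proof -
  obtain n where n: "lower_central G n = {\<one>}"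
    using nilpotent by (auto simp: nilpotent_group_def)
  have "invariant_under (lower_central G (n - j)) f" if "j \<le> n" for j
    using that
  proof (induction j)
    case 0
    then show ?case using invariant_under_one by (simp add: n)
  next
    case (Suc j)
    then have inv: "invariant_under (lower_central G (Suc (n - Suc j))) f"
      by (simp add: Suc_diff_Suc)
    show ?case
      unfolding invariant_under_def
      using bounded_harmonic_right_diff_zero[OF f(1) commutes_with_of_invariant[OF inv] f(2)]
        subgroup.mem_carrier[OF subgroup_lower_central] by blast
  qed
  from this[of n] have "invariant_under (carrier G) f" by simp
  then have "f (\<one> \<otimes> x) = f \<one>" using x unfolding invariant_under_def by blast
  then show ?thesis using x by simp
qed

text \<open>The difference in \<open>z\<close> is harmonic and bounded, hence constant by Liouville;
  its value is read off at \<open>\<one>\<close>.\<close>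

lemma right_diff_const:
  assumes f: "harmonic G \<mu> f" "lin_bounded A B f" "commutes_with z f"
    and z: "z \<in> carrier G" and x: "x \<in> carrier G"
  shows "f (x \<otimes> z) - f x = f z - f \<one>"
  using liouville[OF harmonic_right_diff[OF f(1,3) z] bounded_right_diff[OF f(1,3,2) z] x] z
  by (simp add: right_diff_def)

text \<open>Moving \<open>b ^ n\<close> past \<open>a ^ m\<close> picks up \<open>m n\<close> copies of the commutator, while the word
  length only grows like \<open>m + n\<close>; hence \<open>f\<close> cannot see commutators.\<close>

lemma swap_increment_zero:
  assumes f: "lin_bounded A B f" and a: "a \<in> carrier G" and b: "b \<in> carrier G"
    and swap: "\<And>x y. \<lbrakk>x \<in> carrier G; y \<in> carrier G\<rbrakk> \<Longrightarrow> f (x \<otimes> (a \<otimes> (b \<otimes> y))) = f (x \<otimes> (b \<otimes> (a \<otimes> y))) + c"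
  shows "c = 0"
proof -
  \<comment> \<open>First one \<open>a\<close> passes \<open>n\<close> letters \<open>b\<close>,
    then \<open>m\<close> letters \<open>a\<close> do. The contexts \<open>x\<close> and
    \<open>y\<close> stay arbitrary since each swap happens inside a longer word.\<close>
  have 1: "f (x \<otimes> (a \<otimes> (b [^] n \<otimes> y))) = f (x \<otimes> (b [^] n \<otimes> (a \<otimes> y))) + of_nat n * c"
    if "x \<in> carrier G" "y \<in> carrier G" for x y and n :: nat
    using that
  proof (induction n arbitrary: x y)
    case 0
    then show ?case using a by simp
  next
    case (Suc n)
    have "f (x \<otimes> (a \<otimes> (b [^] Suc n \<otimes> y))) = f (x \<otimes> (a \<otimes> (b [^] n \<otimes> (b \<otimes> y))))"
      using Suc.prems a b by (simp add: m_assoc)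
    also have "\<dots> = f ((x \<otimes> b [^] n) \<otimes> (a \<otimes> (b \<otimes> y))) + of_nat n * c"
      using Suc.IH[of x "b \<otimes> y"] Suc.prems a b by (simp add: m_assoc)
    also have "\<dots> = f ((x \<otimes> b [^] n) \<otimes> (b \<otimes> (a \<otimes> y))) + c + of_nat n * c"
      using swap[of "x \<otimes> b [^] n" y] Suc.prems b by simp
    also have "\<dots> = f (x \<otimes> (b [^] Suc n \<otimes> (a \<otimes> y))) + of_nat (Suc n) * c"
      using Suc.prems a b by (simp add: m_assoc algebra_simps)
    finally show ?case .
  qed
  have 2: "f (x \<otimes> (a [^] m \<otimes> (b [^] n \<otimes> y))) = f (x \<otimes> (b [^] n \<otimes> (a [^] m \<otimes> y))) + of_nat m * (of_nat n * c)"
    if "x \<in> carrier G" "y \<in> carrier G" for x y and m n :: nat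
    using that
  proof (induction m arbitrary: x y)
    case 0
    then show ?case using b by simp
  next
    case (Suc m)
    have "f (x \<otimes> (a [^] Suc m \<otimes> (b [^] n \<otimes> y))) = f ((x \<otimes> a [^] m) \<otimes> (a \<otimes> (b [^] n \<otimes> y)))"
      using Suc.prems a b by (simp add: m_assoc)
    also have "\<dots> = f ((x \<otimes> a [^] m) \<otimes> (b [^] n \<otimes> (a \<otimes> y))) + of_nat n * c"
      using 1[of "x \<otimes> a [^] m" y n] Suc.prems a by simp
    also have "\<dots> = f (x \<otimes> (a [^] m \<otimes> (b [^] n \<otimes> (a \<otimes> y)))) + of_nat n * c"
      using Suc.prems a b by (simp add: m_assoc)
    also have "\<dots> = f (x \<otimes> (b [^] n \<otimes> (a [^] m \<otimes> (a \<otimes> y)))) + of_nat m * (of_nat n * c) + of_nat n * c"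
      using Suc.IH[of x "a \<otimes> y"] Suc.prems a by simp
    also have "\<dots> = f (x \<otimes> (b [^] n \<otimes> (a [^] Suc m \<otimes> y))) + of_nat (Suc m) * (of_nat n * c)"
      using Suc.prems a b by (simp add: m_assoc algebra_simps)
    finally show ?case .
  qed
  have nn: "0 \<le> A" "0 \<le> B" using f by (auto simp: lin_bounded_def)
  have "norm c \<le> 0"
  proof (rule nonpos_of_quadratic_bound)
    fix n :: nat
    \<comment> \<open>The condition on \<open>len g + len h\<close> lets one estimate serve both
      orders of \<open>a\<close> and \<open>b\<close>.\<close>
    have bound: "norm (f (g [^] n \<otimes> h [^] n)) \<le> A + B * (real n * (len a + len b))"
      if "g \<in> carrier G" "h \<in> carrier G" "len g + len h = len a + len b" for g h
    proof -
      have "len (g [^] n \<otimes> h [^] n) \<le> real n * len g + real n * len h"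
        using len_mult[of "g [^] n" "h [^] n"] len_pow[of g n] len_pow[of h n] that by simp
      also have "\<dots> = real n * (len a + len b)"
        unfolding that(3)[symmetric] by (simp add: algebra_simps)
      finally have "B * len (g [^] n \<otimes> h [^] n) \<le> B * (real n * (len a + len b))"
        using nn by (intro mult_left_mono)
      moreover have "norm (f (g [^] n \<otimes> h [^] n)) \<le> A + B * len (g [^] n \<otimes> h [^] n)"
        using f that by (simp add: lin_bounded_def)
      ultimately show ?thesis by linarith
    qed
    have "(of_nat n)\<^sup>2 * c = f (a [^] n \<otimes> b [^] n) - f (b [^] n \<otimes> a [^] n)"
      using 2[of \<one> \<one> n n] a b by (simp add: power2_eq_square mult.assoc)
    then have "(real n)\<^sup>2 * norm c = norm (f (a [^] n \<otimes> b [^] n) - f (b [^] n \<otimes> a [^] n))"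
      by (metis norm_mult norm_of_nat norm_power)
    also have "\<dots> \<le> norm (f (a [^] n \<otimes> b [^] n)) + norm (f (b [^] n \<otimes> a [^] n))"
      by (rule norm_triangle_ineq4)
    also have "\<dots> \<le> 2 * A + real n * (2 * B * (len a + len b))"
      using bound[of a b] bound[of b a] a b by (simp add: algebra_simps)
    finally show "(real n)\<^sup>2 * norm c \<le> 2 * A + real n * (2 * B * (len a + len b))" .
  qed (use nn in auto)
  then show ?thesis by simp
qed

text \<open>The increment of \<open>f\<close> along a commutator of \<open>a\<close> and
  \<open>b\<close> is constant, and invariance under the next term lets the commutator move to the
  end of a word. So this constant is the cost of swapping \<open>a\<close> and \<open>b\<close>,
  which must be 0.\<close>

lemma invariant_under_commutators:
  assumes f: "harmonic G \<mu> f" "lin_bounded A B f"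
    and inv: "invariant_under (lower_central G (Suc (Suc i))) f"
  shows "invariant_under (lower_central G (Suc i)) f"
proof -
  have lcG: "lower_central G i \<subseteq> carrier G" for i
    using subgroup.subset[OF subgroup_lower_central] .
  have "f (x \<otimes> (a \<otimes> b \<otimes> inv a \<otimes> inv b)) = f x"
    if a: "a \<in> lower_central G i" and b: "b \<in> carrier G" and x: "x \<in> carrier G" for a b x
  proof -
    define z where "z = a \<otimes> b \<otimes> inv a \<otimes> inv b"
    have aG: "a \<in> carrier G" using a lcG by blast
    have z: "z \<in> lower_central G (Suc i)"
      unfolding z_def by (rule commutator_in_lower_central[OF a b])
    then have zG: "z \<in> carrier G" using lcG by blast
    have comm: "commutes_with z f"
      using commutes_with_of_invariant[OF inv z] .
    have zba: "z \<otimes> (b \<otimes> (a \<otimes> y)) = a \<otimes> (b \<otimes> y)" if y: "y \<in> carrier G" for y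
      using aG b y by (simp add: z_def m_assoc mult_inv_cancel)
    have "f (u \<otimes> (a \<otimes> (b \<otimes> y))) = f (u \<otimes> (b \<otimes> (a \<otimes> y))) + (f z - f \<one>)"
      if u: "u \<in> carrier G" and y: "y \<in> carrier G" for u y
    proof -
      have w: "b \<otimes> (a \<otimes> y) \<in> carrier G" using aG b y by simp
      have "f (u \<otimes> (a \<otimes> (b \<otimes> y))) = f (u \<otimes> z \<otimes> (b \<otimes> (a \<otimes> y)))"
        using zba[OF y] u zG w by (simp add: m_assoc)
      also have "\<dots> = f (u \<otimes> (b \<otimes> (a \<otimes> y)) \<otimes> z)"
        using comm u w unfolding commutes_with_def by simp
      also have "\<dots> = f (u \<otimes> (b \<otimes> (a \<otimes> y))) + (f z - f \<one>)"
        using right_diff_const[OF f comm zG, of "u \<otimes> (b \<otimes> (a \<otimes> y))"] u w by (simp add: algebra_simps)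
      finally show ?thesis .
    qed
    then have "f z - f \<one> = 0"
      by (rule swap_increment_zero[OF f(2) aG b])
    then show ?thesis
      using right_diff_const[OF f comm zG x] by (simp add: z_def)
  qed
  then have "invariant_under (\<Union>x \<in> lower_central G i. \<Union>y \<in> carrier G. {x \<otimes> y \<otimes> inv x \<otimes> inv y}) f"
    unfolding invariant_under_def by blast
  moreover have "(\<Union>x \<in> lower_central G i. \<Union>y \<in> carrier G. {x \<otimes> y \<otimes> inv x \<otimes> inv y}) \<subseteq> carrier G"
    using lcG[of i] by auto
  ultimately show ?thesis
    unfolding lower_central.simps(2)[of G i] by (intro invariant_under_generate)
qed

text \<open>Climbing the series up to the commutator subgroup makes every \<open>y\<close> commute
  with \<open>f\<close>, so every increment is constant.\<close>

lemma linear_growth_harmonic_affine: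
  assumes f: "harmonic G \<mu> f" "lin_bounded A B f" and x: "x \<in> carrier G" and y: "y \<in> carrier G"
  shows "f (x \<otimes> y) - f x = f y - f \<one>"
proof -
  obtain n where n: "lower_central G n = {\<one>}"
    using nilpotent by (auto simp: nilpotent_group_def)
  \<comment> \<open>Starting one term beyond \<open>n\<close> keeps every index in the form
    \<open>Suc\<close>, also for \<open>n = 0\<close>.\<close>
  have "lower_central G (Suc n) \<subseteq> {\<one>}"
    using generate_is_subgroup n by (auto simp: generate_one)
  then have "invariant_under (lower_central G (Suc n)) f"
    using invariant_under_one unfolding invariant_under_def by blast
  then have "invariant_under (lower_central G (Suc (n - j))) f" if "j \<le> n" for j
    using that
  proof (induction j)
    case (Suc j)
    then have "invariant_under (lower_central G (Suc (Suc (n - Suc j)))) f"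
      by (simp add: Suc_diff_Suc)
    then show ?case by (rule invariant_under_commutators[OF f])
  qed simp
  from this[of n] have "invariant_under (lower_central G (Suc 0)) f" by simp
  then have "commutes_with y f"
    using commutes_with_of_invariant[of 0 f y] y by simp
  then show ?thesis using right_diff_const[OF f _ y x] by blast
qed

end

subsection \<open>The abelianization and its real tensor product\<close>

lemma group_complex_add: "group complex_add_group"
  by (rule groupI) (auto simp: complex_add_group_def intro: exI[of _ "- x" for x])

lemma comm_group_real_add: "comm_group real_add_group"
  by (rule comm_groupI) (auto simp: real_add_group_def intro: exI[of _ "- x" for x])

text \<open>The biadditive map sending \<open>(a, r)\<close> to \<open>r * \<psi> a\<close> extends
  to the free abelian group and kills the tensor relations, so it descends to the quotient.\<close>

lemma (in comm_group) tensor_functional_of_additive: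
  fixes \<psi> :: "'a \<Rightarrow> real"
  assumes add: "\<And>x y. \<lbrakk>x \<in> carrier G; y \<in> carrier G\<rbrakk> \<Longrightarrow> \<psi> (x \<otimes> y) = \<psi> x + \<psi> y"
  obtains L where "L \<in> tensor_functionals G"
    "\<And>a r. a \<in> carrier G \<Longrightarrow> L (pure_tensor G a r) = r * \<psi> a"
proof -
  define F where "F = free_Abelian_group (carrier G \<times> (UNIV :: real set))"
  interpret R: comm_group real_add_group by (rule comm_group_real_add)
  interpret F: comm_group F
    unfolding F_def by (rule abelian_free_Abelian_group)
  obtain h where h: "h \<in> hom F real_add_group"
    and hf: "\<And>x. x \<in> carrier G \<times> UNIV \<Longrightarrow> h (frag_of x) = snd x * \<psi> (fst x)"
    using R.free_Abelian_group_universal[of "\<lambda>x. snd x * \<psi> (fst x)" "carrier G \<times> UNIV"]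
    unfolding F_def by (auto simp: real_add_group_def)
  interpret h: group_hom F real_add_group h
    by (simp add: group_hom_def group_hom_axioms_def F.is_group R.is_group h)
  define rels where "rels = {frag_of (a \<otimes> b, r) - frag_of (a, r) - frag_of (b, r) | a b r.
         a \<in> carrier G \<and> b \<in> carrier G} \<union>
      {frag_of (a, r + s) - frag_of (a, r) - frag_of (a, s) | a r s :: real. a \<in> carrier G}"
  have TR: "tensor_relations G = generate F rels"
    by (simp add: tensor_relations_def F_def rels_def)
  have fragF: "frag_of (a, r) \<in> carrier F" if "a \<in> carrier G" for a and r :: real
    using that by (simp add: F_def free_Abelian_group_def)
  have diffF: "u - v \<in> carrier F" "h (u - v) = h u - h v" if "u \<in> carrier F" "v \<in> carrier F" for u v
  proof -
    show uv: "u - v \<in> carrier F"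
      using that keys_diff[of u v] by (auto simp: F_def free_Abelian_group_def)
    have "h ((u - v) \<otimes>\<^bsub>F\<^esub> v) = h (u - v) \<otimes>\<^bsub>real_add_group\<^esub> h v"
      using uv that by simp
    then show "h (u - v) = h u - h v"
      by (simp add: F_def free_Abelian_group_def real_add_group_def)
  qed
  have rels_ker: "rels \<subseteq> kernel F real_add_group h"
  proof
    fix u assume "u \<in> rels"
    then consider (left) a b r where "a \<in> carrier G" "b \<in> carrier G"
        "u = frag_of (a \<otimes> b, r) - frag_of (a, r) - frag_of (b, r)"
      | (right) a r s where "a \<in> carrier G" "u = frag_of (a, r + s) - frag_of (a, r) - frag_of (a, s)"
      unfolding rels_def by blast
    then have "u \<in> carrier F \<and> h u = 0"
    proof cases
      case left
      then have "h u = r * \<psi> (a \<otimes> b) - r * \<psi> a - r * \<psi> b"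
        using fragF by (simp add: diffF hf)
      then have "h u = 0"
        using left(1,2) by (simp add: add algebra_simps)
      moreover have "u \<in> carrier F"
        unfolding left(3) using left(1,2) by (intro diffF(1) fragF m_closed)
      ultimately show ?thesis by blast
    next
      case right
      then have "h u = (r + s) * \<psi> a - r * \<psi> a - s * \<psi> a"
        using fragF by (simp add: diffF hf)
      then have "h u = 0"
        by (simp add: algebra_simps)
      moreover have "u \<in> carrier F"
        unfolding right(2) using right(1) by (intro diffF(1) fragF)
      ultimately show ?thesis by blast
    qed
    then show "u \<in> kernel F real_add_group h"
      by (simp add: kernel_def real_add_group_def)
  qed
  have "subgroup (kernel F real_add_group h) F"
    by (rule h.subgroup_kernel)
  then have ker: "tensor_relations G \<subseteq> kernel F real_add_group h"
    unfolding TR by (rule F.generate_subgroup_incl[OF rels_ker])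
  have "subgroup (tensor_relations G) F"
    unfolding TR using rels_ker by (intro F.generate_is_subgroup) (auto simp: kernel_def)
  then have "tensor_relations G \<lhd> F"
    by (rule F.subgroup_imp_normal)
  then obtain L where L: "L \<in> hom (F Mod tensor_relations G) real_add_group"
    and Lh: "\<And>x. x \<in> carrier F \<Longrightarrow> L (tensor_relations G #>\<^bsub>F\<^esub> x) = h x"
    using h.FactGroup_universal_kernel ker by blast
  have Lp: "L (pure_tensor G a r) = r * \<psi> a" if "a \<in> carrier G" for a r
    using Lh[OF fragF[OF that]] hf that by (simp add: pure_tensor_def F_def)
  have "L \<in> tensor_functionals G"
    using L Lp by (simp add: tensor_functionals_def tensor_real_def F_def)
  with Lp show ?thesis using that by blast
qed

lemma (in comm_group) comm_group_tensor_real: "comm_group (tensor_real G)"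
proof -
  define F where "F = free_Abelian_group (carrier G \<times> (UNIV :: real set))"
  interpret F: comm_group F
    unfolding F_def by (rule abelian_free_Abelian_group)
  have diffF: "u - v \<in> carrier F" if "u \<in> carrier F" "v \<in> carrier F" for u v
    using that keys_diff[of u v] by (auto simp: F_def free_Abelian_group_def)
  have fragF: "frag_of (a, r) \<in> carrier F" if "a \<in> carrier G" for a and r :: real
    using that by (simp add: F_def free_Abelian_group_def)
  have "subgroup (tensor_relations G) F"
    unfolding tensor_relations_def F_def[symmetric]
    by (rule F.generate_is_subgroup) (blast intro: diffF fragF m_closed)
  then show ?thesis
    unfolding tensor_real_def F_def[symmetric]
    by (intro F.abelian_FactGroup)
qed

lemma (in comm_group) pure_tensor_closed:
  assumes "a \<in> carrier G"
  shows "pure_tensor G a r \<in> carrier (tensor_real G)"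
  using assms unfolding tensor_real_def pure_tensor_def
  by (auto simp: FactGroup_def RCOSETS_def intro!: bexI[of _ "frag_of (a, r)"])

lemma hom_finprod_real:
  assumes "comm_group T" "L \<in> hom T real_add_group" "finite X" "f \<in> X \<rightarrow> carrier T"
  shows "L (finprod T f X) = (\<Sum>x\<in>X. L (f x))"
proof -
  interpret T: comm_group T by fact
  interpret L: group_hom T real_add_group L
    using assms comm_group_real_add
    by (simp add: group_hom_def group_hom_axioms_def comm_group_def)
  show ?thesis
    using assms(3,4)
  proof (induction X rule: finite_induct)
    case empty
    then show ?case using L.hom_one by (simp add: real_add_group_def)
  next
    case (insert x X)
    then have "L (finprod T f (insert x X)) = L (f x) \<otimes>\<^bsub>real_add_group\<^esub> L (finprod T f X)"
      by (subst T.finprod_insert) (auto intro!: L.hom_mult T.finprod_closed)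
    with insert show ?case by (simp add: real_add_group_def)
  qed
qed

section \<open>Homomorphisms on the abelianization and the centering condition\<close>

context group
begin

lemma normal_derived: "derived G (carrier G) \<lhd> G"
  by (rule derived_self_is_normal)

lemma comm_group_abelianization: "comm_group (abelianization G)"
  unfolding abelianization_def by (rule derived_quot_is_comm_group)

lemma carrier_abelianization: "carrier (abelianization G) = ab_class G ` carrier G"
  by (auto simp: abelianization_def FactGroup_def RCOSETS_def ab_class_def)

lemma ab_class_mult:
  assumes "x \<in> carrier G" "y \<in> carrier G"
  shows "ab_class G (x \<otimes> y) = ab_class G x \<otimes>\<^bsub>abelianization G\<^esub> ab_class G y"
  using normal.rcos_sum[OF normal_derived assms]
  by (simp add: abelianization_def ab_class_def FactGroup_def)

text \<open>An additive map into the complex numbers kills commutators and therefore factors through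
  the abelianization.\<close>

lemma Hom_ab_of_additive:
  fixes \<psi> :: "'a \<Rightarrow> complex"
  assumes add: "\<And>x y. \<lbrakk>x \<in> carrier G; y \<in> carrier G\<rbrakk> \<Longrightarrow> \<psi> (x \<otimes> y) = \<psi> x + \<psi> y"
  obtains \<phi> where "\<phi> \<in> Hom_ab G" "\<And>x. x \<in> carrier G \<Longrightarrow> \<phi> (ab_class G x) = \<psi> x"
proof -
  interpret C: group complex_add_group by (rule group_complex_add)
  interpret \<psi>: group_hom G complex_add_group \<psi>
    by unfold_locales (auto simp: hom_def complex_add_group_def add)
  have inv0: "\<psi> (inv x) = - \<psi> x" if "x \<in> carrier G" for x
  proof -
    have "\<psi> (inv x) + \<psi> x = \<psi> \<one>" using that add[of "inv x" x] by simp
    moreover have "\<psi> \<one> = 0" using add[of \<one> \<one>] by simp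
    ultimately show ?thesis by (simp add: eq_neg_iff_add_eq_0)
  qed
  have "derived_set G (carrier G) \<subseteq> kernel G complex_add_group \<psi>"
    by (auto simp: kernel_def complex_add_group_def add inv0 simp del: \<psi>.hom_inv \<psi>.hom_mult)
  then have "derived G (carrier G) \<subseteq> kernel G complex_add_group \<psi>"
    unfolding derived_def by (intro generate_subgroup_incl \<psi>.subgroup_kernel)
  then obtain \<phi> where \<phi>: "\<phi> \<in> hom (abelianization G) complex_add_group"
    and \<phi>c: "\<And>x. x \<in> carrier G \<Longrightarrow> \<phi> (ab_class G x) = \<psi> x"
    using \<psi>.FactGroup_universal_kernel[OF normal_derived]
    unfolding abelianization_def ab_class_def by blast
  interpret A: comm_group "abelianization G" by (rule comm_group_abelianization)
  \<comment> \<open>Restriction selects the extensional representative that \<open>Hom_ab\<close>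
    requires.\<close>
  have "restrict \<phi> (carrier (abelianization G)) \<in> Hom_ab G"
    using \<phi> by (auto simp: Hom_ab_def hom_def)
  moreover have "restrict \<phi> (carrier (abelianization G)) (ab_class G x) = \<psi> x" if "x \<in> carrier G" for x
    using \<phi>c that by (simp add: carrier_abelianization)
  ultimately show ?thesis using that by blast
qed

lemma Hom_ab_add:
  assumes "\<phi> \<in> Hom_ab G" "x \<in> carrier G" "y \<in> carrier G"
  shows "\<phi> (ab_class G (x \<otimes> y)) = \<phi> (ab_class G x) + \<phi> (ab_class G y)"
proof -
  have "ab_class G x \<in> carrier (abelianization G)" "ab_class G y \<in> carrier (abelianization G)"
    using assms by (auto simp: carrier_abelianization)
  then show ?thesis
    using assms by (auto simp: Hom_ab_def hom_def ab_class_mult complex_add_group_def)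
qed

text \<open>\<open>\<psi>\<close> induces a linear functional on the tensor product, continuous by
  the choice of topology. It carries convergence of the finite products to the identity over to real
  partial sums.\<close>

lemma has_sum_of_abelian_centered:
  assumes cen: "abelian_centered G \<mu>"
    and add: "\<And>a b. \<lbrakk>a \<in> carrier (abelianization G); b \<in> carrier (abelianization G)\<rbrakk> \<Longrightarrow>
      \<psi> (a \<otimes>\<^bsub>abelianization G\<^esub> b) = \<psi> a + (\<psi> b :: real)"
  shows "((\<lambda>g. pmf \<mu> g * \<psi> (ab_class G g)) has_sum 0) (carrier G)"
proof -
  define A where "A = abelianization G"
  interpret A: comm_group A unfolding A_def by (rule comm_group_abelianization)
  interpret T: comm_group "tensor_real A" by (rule A.comm_group_tensor_real)
  obtain L where L: "L \<in> tensor_functionals A"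
    and Lp: "\<And>a r. a \<in> carrier A \<Longrightarrow> L (pure_tensor A a r) = r * \<psi> a"
    using A.tensor_functional_of_additive add unfolding A_def by blast
  have Lhom: "L \<in> hom (tensor_real A) real_add_group"
    using L by (simp add: tensor_functionals_def)
  define X where "X F = finprod (tensor_real A) (\<lambda>g. pure_tensor A (ab_class G g) (pmf \<mu> g)) F" for F
  have classA: "ab_class G g \<in> carrier A" if "g \<in> carrier G" for g
    using that by (simp add: A_def carrier_abelianization)
  have LX: "L (X F) = (\<Sum>g\<in>F. pmf \<mu> g * \<psi> (ab_class G g))" if "finite F" "F \<subseteq> carrier G" for F
  proof -
    have "L (X F) = (\<Sum>g\<in>F. L (pure_tensor A (ab_class G g) (pmf \<mu> g)))"
      unfolding X_def using that classA A.pure_tensor_closed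
      by (intro hom_finprod_real[OF T.comm_group_axioms Lhom]) auto
    also have "\<dots> = (\<Sum>g\<in>F. pmf \<mu> g * \<psi> (ab_class G g))"
      using that classA Lp by (intro sum.cong) auto
    finally show ?thesis .
  qed
  have lim: "limitin (tensor_topology A) X \<one>\<^bsub>tensor_real A\<^esub> (finite_subsets_at_top (carrier G))"
    using cen by (simp add: abelian_centered_def has_ab_mean_def A_def X_def[abs_def])
  have L1: "L \<one>\<^bsub>tensor_real A\<^esub> = 0"
    using hom_finprod_real[OF T.comm_group_axioms Lhom, of "{}"] by simp
  have "((\<lambda>F. \<Sum>g\<in>F. pmf \<mu> g * \<psi> (ab_class G g)) \<longlongrightarrow> 0) (finite_subsets_at_top (carrier G))"
  proof (rule topological_tendstoI)
    fix U :: "real set" assume U: "open U" "0 \<in> U"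
    have "openin (tensor_topology A) {t \<in> carrier (tensor_real A). L t \<in> U}"
      unfolding tensor_topology_def by (rule topology_generated_by_Basis) (use L U in blast)
    moreover have "\<one>\<^bsub>tensor_real A\<^esub> \<in> {t \<in> carrier (tensor_real A). L t \<in> U}"
      using L1 U by simp
    ultimately have "eventually (\<lambda>F. X F \<in> {t \<in> carrier (tensor_real A). L t \<in> U}) (finite_subsets_at_top (carrier G))"
      using lim unfolding limitin_def by blast
    moreover have "eventually (\<lambda>F. finite F \<and> F \<subseteq> carrier G) (finite_subsets_at_top (carrier G))"
      by (rule eventually_finite_subsets_at_top_weakI) auto
    ultimately show "eventually (\<lambda>F. (\<Sum>g\<in>F. pmf \<mu> g * \<psi> (ab_class G g)) \<in> U) (finite_subsets_at_top (carrier G))"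
      by eventually_elim (use LX in auto)
  qed
  then show ?thesis by (simp add: has_sum_def)
qed

text \<open>The tensor functionals are real valued, so real and imaginary parts are treated
  separately.\<close>

lemma has_sum_Hom_ab_of_abelian_centered:
  assumes cen: "abelian_centered G \<mu>" and \<phi>: "\<phi> \<in> Hom_ab G"
  shows "((\<lambda>g. complex_of_real (pmf \<mu> g) * \<phi> (ab_class G g)) has_sum 0) (carrier G)"
proof -
  have add: "\<phi> (a \<otimes>\<^bsub>abelianization G\<^esub> b) = \<phi> a + \<phi> b"
    if "a \<in> carrier (abelianization G)" "b \<in> carrier (abelianization G)" for a b
    using \<phi> that by (auto simp: Hom_ab_def hom_def complex_add_group_def)
  have "((\<lambda>g. complex_of_real (pmf \<mu> g * Re (\<phi> (ab_class G g)))) has_sum of_real 0) (carrier G)"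
    by (intro has_sum_of_real has_sum_of_abelian_centered[OF cen]) (simp add: add)
  moreover have "((\<lambda>g. \<i> * complex_of_real (pmf \<mu> g * Im (\<phi> (ab_class G g)))) has_sum \<i> * of_real 0) (carrier G)"
    by (intro has_sum_cmult_right has_sum_of_real has_sum_of_abelian_centered[OF cen]) (simp add: add)
  ultimately have "((\<lambda>g. complex_of_real (pmf \<mu> g * Re (\<phi> (ab_class G g)))
      + \<i> * complex_of_real (pmf \<mu> g * Im (\<phi> (ab_class G g)))) has_sum (of_real 0 + \<i> * of_real 0)) (carrier G)"
    by (rule has_sum_add)
  moreover have "complex_of_real (pmf \<mu> g * Re w) + \<i> * complex_of_real (pmf \<mu> g * Im w)
      = complex_of_real (pmf \<mu> g) * w" for g w
    by (simp add: complex_eq_iff)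
  ultimately show ?thesis by simp
qed

end

subsection \<open>Affine functions\<close>

context group_with_generators
begin

text \<open>Summing increments along a shortest word shows that Lipschitz functions grow at most
  linearly.\<close>

lemma lin_bounded_of_increments:
  assumes K: "0 \<le> K" and inc: "\<And>s x. \<lbrakk>s \<in> S; x \<in> carrier G\<rbrakk> \<Longrightarrow> norm (f (x \<otimes> s) - f x) \<le> K"
  shows "lin_bounded (norm (f \<one>)) K f"
proof -
  have word: "norm (f (y \<otimes> foldr (\<otimes>) ws \<one>) - f y) \<le> K * real (length ws)"
    if "set ws \<subseteq> S" "y \<in> carrier G" for ws y
    using that
  proof (induction ws arbitrary: y)
    case Nil
    then show ?case by simp
  next
    case (Cons w ws)
    have w: "w \<in> S" "w \<in> carrier G" "set ws \<subseteq> carrier G"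
      using Cons.prems S_carrier by auto
    have "y \<otimes> foldr (\<otimes>) (w # ws) \<one> = y \<otimes> w \<otimes> foldr (\<otimes>) ws \<one>"
      using w Cons.prems foldr_append(1)[OF w(3) w(3)] by (simp add: m_assoc)
    moreover have "norm (f (y \<otimes> w \<otimes> foldr (\<otimes>) ws \<one>) - f (y \<otimes> w)) \<le> K * real (length ws)"
      using Cons w by simp
    moreover have "norm (f (y \<otimes> w) - f y) \<le> K"
      using inc w Cons.prems by blast
    ultimately show ?case
      using norm_triangle_ineq[of "f (y \<otimes> w \<otimes> foldr (\<otimes>) ws \<one>) - f (y \<otimes> w)" "f (y \<otimes> w) - f y"]
      by (simp add: algebra_simps)
  qed
  have "norm (f x) \<le> norm (f \<one>) + K * len x" if x: "x \<in> carrier G" for x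
  proof -
    obtain ws where "length ws = word_length G S x" "set ws \<subseteq> S" "foldr (\<otimes>) ws \<one> = x"
      using ex_shortest_word[OF x] by blast
    then have "norm (f x - f \<one>) \<le> K * len x"
      using word[of ws \<one>] x by simp
    then show ?thesis
      using norm_triangle_ineq[of "f x - f \<one>" "f \<one>"] by simp
  qed
  then show ?thesis using K by (simp add: lin_bounded_def)
qed

lemma gradient_norm_finite_iff:
  "gradient_norm G S f < \<infinity> \<longleftrightarrow> (\<exists>K \<ge> 0. \<forall>s \<in> S. \<forall>x \<in> carrier G. norm (f (x \<otimes> s) - f x) \<le> K)"
proof
  assume "gradient_norm G S f < \<infinity>"
  then obtain K where K: "0 \<le> K" "gradient_norm G S f = ennreal K"
    by (cases "gradient_norm G S f") auto
  have "norm (f (x \<otimes> s) - f x) \<le> K" if "s \<in> S" "x \<in> carrier G" for s x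
  proof -
    have "ennreal (norm (f (x \<otimes> s) - f x)) \<le> (SUP x \<in> carrier G. ennreal (norm (f (x \<otimes> s) - f x)))"
      using that by (intro SUP_upper)
    also have "\<dots> \<le> gradient_norm G S f"
      unfolding gradient_norm_def using that by (intro SUP_upper)
    finally show ?thesis using K by simp
  qed
  with K show "\<exists>K \<ge> 0. \<forall>s \<in> S. \<forall>x \<in> carrier G. norm (f (x \<otimes> s) - f x) \<le> K" by blast
next
  assume "\<exists>K \<ge> 0. \<forall>s \<in> S. \<forall>x \<in> carrier G. norm (f (x \<otimes> s) - f x) \<le> K"
  then obtain K where K: "0 \<le> K" "\<forall>s \<in> S. \<forall>x \<in> carrier G. norm (f (x \<otimes> s) - f x) \<le> K" by blast
  then have "gradient_norm G S f \<le> ennreal K"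
    unfolding gradient_norm_def by (intro SUP_least ennreal_leI) blast
  then show "gradient_norm G S f < \<infinity>"
    using le_less_trans by fastforce
qed

lemma norm_le_max_on_ball:
  assumes "x \<in> carrier G" "word_length G S x \<le> r"
  shows "norm (f x) \<le> max_on_ball G S f r"
  unfolding max_on_ball_def using assms finite_balls by (intro Max_ge) auto

lemma limsup_max_on_ball_finite_iff:
  "limsup (\<lambda>r. ereal (max_on_ball G S f r / real r)) < \<infinity> \<longleftrightarrow> (\<exists>A B. lin_bounded A B f)"
proof
  assume "limsup (\<lambda>r. ereal (max_on_ball G S f r / real r)) < \<infinity>"
  then obtain C :: nat where "limsup (\<lambda>r. ereal (max_on_ball G S f r / real r)) < ereal (real C)"
    using less_PInf_Ex_of_nat by auto
  then have "eventually (\<lambda>r. ereal (max_on_ball G S f r / real r) < ereal (real C)) sequentially"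
    by (rule Limsup_lessD)
  then obtain N0 where N0: "\<And>r. r \<ge> N0 \<Longrightarrow> max_on_ball G S f r / real r < real C"
    by (auto simp: eventually_sequentially)
  \<comment> \<open>Adding \<open>N\<close> to the length of \<open>x\<close> gives a radius beyond
    the threshold, and \<open>Suc\<close> makes it positive so that the division by \<open>r\<close>
    can be undone.\<close>
  define N where "N = Suc N0"
  have "norm (f x) \<le> real C * real N + real C * len x" if x: "x \<in> carrier G" for x
  proof -
    define r where "r = N + word_length G S x"
    have "norm (f x) \<le> max_on_ball G S f r"
      using x by (intro norm_le_max_on_ball) (auto simp: r_def)
    also have "\<dots> \<le> real C * real r"
      using N0[of r] by (simp add: r_def N_def field_simps)
    finally show ?thesis by (simp add: r_def algebra_simps)
  qed
  then have "lin_bounded (real C * real N) (real C) f"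
    by (simp add: lin_bounded_def)
  then show "\<exists>A B. lin_bounded A B f" by blast
next
  assume "\<exists>A B. lin_bounded A B f"
  then obtain A B where f: "lin_bounded A B f" by blast
  then have nn: "0 \<le> A" "0 \<le> B" by (auto simp: lin_bounded_def)
  have "max_on_ball G S f r / real r \<le> A + B" if "r \<ge> 1" for r
  proof -
    have "max_on_ball G S f r \<le> A + B * real r"
      unfolding max_on_ball_def
    proof (rule Max.boundedI)
      show "(\<lambda>x. norm (f x)) ` {x \<in> carrier G. word_length G S x \<le> r} \<noteq> {}"
        using word_length_one by auto
      fix v assume "v \<in> (\<lambda>x. norm (f x)) ` {x \<in> carrier G. word_length G S x \<le> r}"
      then obtain x where x: "x \<in> carrier G" "word_length G S x \<le> r" "v = norm (f x)" by blast
      have "B * len x \<le> B * real r"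
        using x nn by (intro mult_left_mono) auto
      then show "v \<le> A + B * real r"
        using f x unfolding lin_bounded_def by fastforce
    qed (use finite_balls in simp)
    also have "\<dots> \<le> (A + B) * real r"
      using nn that mult_left_mono[of 1 "real r" A] by (simp add: algebra_simps)
    finally show ?thesis using that by (simp add: field_simps)
  qed
  then have "limsup (\<lambda>r. ereal (max_on_ball G S f r / real r)) \<le> ereal (A + B)"
    by (intro Limsup_bounded) (auto simp: eventually_sequentially)
  then show "limsup (\<lambda>r. ereal (max_on_ball G S f r / real r)) < \<infinity>"
    using le_less_trans by fastforce
qed

lemma Hom_ab_increments_bounded:
  assumes "\<phi> \<in> Hom_ab G"
  shows "\<exists>K \<ge> 0. \<forall>s \<in> S. \<forall>x \<in> carrier G.
    norm (affine_fun G \<phi> c (x \<otimes> s) - affine_fun G \<phi> c x) \<le> K"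
proof (intro exI conjI ballI)
  \<comment> \<open>The sum over \<open>S\<close> serves as the bound; unlike a maximum it also
    makes sense for empty \<open>S\<close>.\<close>
  show "0 \<le> (\<Sum>s\<in>S. norm (\<phi> (ab_class G s)))" by (rule sum_nonneg) simp
  fix s x assume s: "s \<in> S" and x: "x \<in> carrier G"
  then have sG: "s \<in> carrier G" using S_carrier by blast
  have "affine_fun G \<phi> c (x \<otimes> s) - affine_fun G \<phi> c x = \<phi> (ab_class G s)"
    using x sG Hom_ab_add[OF assms x sG] by (simp add: affine_fun_def)
  moreover have "norm (\<phi> (ab_class G s)) \<le> (\<Sum>s\<in>S. norm (\<phi> (ab_class G s)))"
    using s finite_S by (intro member_le_sum) auto
  ultimately show "norm (affine_fun G \<phi> c (x \<otimes> s) - affine_fun G \<phi> c x) \<le> (\<Sum>s\<in>S. norm (\<phi> (ab_class G s)))"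
    by simp
qed

end

section \<open>The linear space of affine functions\<close>

context group
begin

text \<open>The common value of the three function spaces; each of them is compared with it.\<close>

abbreviation affine_funs :: "('a \<Rightarrow> complex) set" where
  "affine_funs \<equiv> (\<lambda>(\<phi>, c). affine_fun G \<phi> c) ` (Hom_ab G \<times> UNIV)"

lemma affine_fun_in_affine_funs: "\<phi> \<in> Hom_ab G \<Longrightarrow> affine_fun G \<phi> c \<in> affine_funs"
  by (rule image_eqI[of _ _ "(\<phi>, c)"]) auto

lemma affine_funs_of_additive:
  assumes ext: "f \<in> extensional (carrier G)"
    and add: "\<And>x y. \<lbrakk>x \<in> carrier G; y \<in> carrier G\<rbrakk> \<Longrightarrow> f (x \<otimes> y) - f x = f y - f \<one>"
  shows "f \<in> affine_funs"
proof -
  have "f (x \<otimes> y) - f \<one> = (f x - f \<one>) + (f y - f \<one>)" if "x \<in> carrier G" "y \<in> carrier G" for x y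
    using add[OF that] by (simp add: algebra_simps)
  then obtain \<phi> where \<phi>: "\<phi> \<in> Hom_ab G" "\<And>x. x \<in> carrier G \<Longrightarrow> \<phi> (ab_class G x) = f x - f \<one>"
    using Hom_ab_of_additive[of "\<lambda>x. f x - f \<one>"] by blast
  have "f = affine_fun G \<phi> (f \<one>)"
    using ext \<phi>(2) by (auto simp: affine_fun_def extensional_def fun_eq_iff)
  then show ?thesis
    using affine_fun_in_affine_funs[OF \<phi>(1)] by metis
qed

lemma P1_eq_affine_funs: "P1 G = affine_funs"
proof
  show "P1 G \<subseteq> affine_funs"
  proof
    fix f assume f: "f \<in> P1 G"
    show "f \<in> affine_funs"
    proof (rule affine_funs_of_additive)
      show "f \<in> extensional (carrier G)" using f by (simp add: P1_def)
      fix x y assume xy: "x \<in> carrier G" "y \<in> carrier G"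
      \<comment> \<open>At \<open>\<one>\<close> the second difference is
        \<open>(f (x \<otimes> y) - f y) - (f x - f \<one>)\<close>, which is already the additivity
        sought.\<close>
      have "left_diff G y (left_diff G x f) \<one> = 0"
        using f xy unfolding P1_def by blast
      then show "f (x \<otimes> y) - f x = f y - f \<one>"
        using xy by (simp add: left_diff_def algebra_simps)
    qed
  qed
  show "affine_funs \<subseteq> P1 G"
    by (auto simp: P1_def left_diff_def affine_fun_def Hom_ab_add)
qed

text \<open>The constant is recovered as the value at \<open>\<one>\<close>, and then the
  homomorphism because the classes exhaust the abelianization.\<close>

lemma inj_on_affine_fun: "inj_on (\<lambda>(\<phi>, c). affine_fun G \<phi> c) (Hom_ab G \<times> UNIV)"
proof (rule inj_onI, clarify)
  fix \<phi> \<psi> c d assume \<phi>: "\<phi> \<in> Hom_ab G" and \<psi>: "\<psi> \<in> Hom_ab G"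
    and eq: "affine_fun G \<phi> c = affine_fun G \<psi> d"
  have pt: "c + \<phi> (ab_class G x) = d + \<psi> (ab_class G x)" if "x \<in> carrier G" for x
    using fun_cong[OF eq, of x] that by (simp add: affine_fun_def)
  have "\<phi> (ab_class G \<one>) = 0" "\<psi> (ab_class G \<one>) = 0"
    using Hom_ab_add[OF \<phi>, of \<one> \<one>] Hom_ab_add[OF \<psi>, of \<one> \<one>] by simp_all
  then have cd: "c = d" using pt[of \<one>] by simp
  have "\<phi> = \<psi>"
  proof (rule extensionalityI)
    show "\<phi> \<in> extensional (carrier (abelianization G))" "\<psi> \<in> extensional (carrier (abelianization G))"
      using \<phi> \<psi> by (auto simp: Hom_ab_def)
    show "\<phi> a = \<psi> a" if "a \<in> carrier (abelianization G)" for a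
      using that pt cd by (auto simp: carrier_abelianization)
  qed
  with cd show "\<phi> = \<psi> \<and> c = d" by blast
qed

lemma affine_fun_add:
  "affine_fun G (fun_add (carrier (abelianization G)) \<phi> \<psi>) (c + d)
    = fun_add (carrier G) (affine_fun G \<phi> c) (affine_fun G \<psi> d)"
  by (auto simp: affine_fun_def fun_add_def fun_eq_iff carrier_abelianization)

lemma affine_fun_scale:
  "affine_fun G (fun_scale (carrier (abelianization G)) a \<phi>) (a * c)
    = fun_scale (carrier G) a (affine_fun G \<phi> c)"
  by (auto simp: affine_fun_def fun_scale_def fun_eq_iff carrier_abelianization algebra_simps)

lemma fun_subspace_Hom_ab: "fun_subspace (carrier (abelianization G)) (Hom_ab G)"
proof -
  interpret A: comm_group "abelianization G" by (rule comm_group_abelianization)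
  show ?thesis
    by (auto simp: fun_subspace_def Hom_ab_def hom_def complex_add_group_def fun_add_def fun_scale_def algebra_simps)
qed

lemma fun_subspace_affine_funs: "fun_subspace (carrier G) affine_funs"
  unfolding fun_subspace_def
proof (intro conjI allI ballI)
  note H = fun_subspace_Hom_ab[unfolded fun_subspace_def]
  show "affine_funs \<subseteq> extensional (carrier G)"
    by (auto simp: affine_fun_def)
  have "affine_fun G (\<lambda>x\<in>carrier (abelianization G). 0) 0 = (\<lambda>x\<in>carrier G. 0)"
    by (auto simp: affine_fun_def fun_eq_iff carrier_abelianization)
  then show "(\<lambda>x\<in>carrier G. 0) \<in> affine_funs"
    using affine_fun_in_affine_funs H by metis
  show "fun_add (carrier G) f g \<in> affine_funs" if "f \<in> affine_funs" "g \<in> affine_funs" for f g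
    using that affine_fun_in_affine_funs H by (auto simp flip: affine_fun_add)
  show "fun_scale (carrier G) a f \<in> affine_funs" if f: "f \<in> affine_funs" for a f
  proof -
    obtain \<phi> c where "\<phi> \<in> Hom_ab G" "f = affine_fun G \<phi> c" using f by auto
    then show ?thesis
      using affine_fun_in_affine_funs[of "fun_scale (carrier (abelianization G)) a \<phi>" "a * c"] H
      by (simp add: affine_fun_scale)
  qed
qed

lemma linear_iso_affine_funs:
  "linear_iso_sum_complex (carrier (abelianization G)) (Hom_ab G) (carrier G) affine_funs
    (\<lambda>(\<phi>, c). affine_fun G \<phi> c)"
  unfolding linear_iso_sum_complex_def bij_betw_def
  using fun_subspace_Hom_ab fun_subspace_affine_funs inj_on_affine_fun
  by (simp add: affine_fun_add affine_fun_scale)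

end

context random_walk
begin

text \<open>One step adds \<open>\<phi>\<close> of its class to the value at \<open>k\<close>; total
  mass 1 reproduces that value, and centering cancels the mean of the added term.\<close>

lemma harmonic_affine_fun:
  assumes cen: "abelian_centered G \<mu>" and \<phi>: "\<phi> \<in> Hom_ab G"
  shows "harmonic G \<mu> (affine_fun G \<phi> c)"
  unfolding harmonic_def
proof (intro ballI conjI)
  fix k assume k: "k \<in> carrier G"
  let ?f = "affine_fun G \<phi> c"
  obtain K where "0 \<le> K" "\<forall>s \<in> S. \<forall>x \<in> carrier G. norm (?f (x \<otimes> s) - ?f x) \<le> K"
    using Hom_ab_increments_bounded[OF \<phi>] by blast
  then have "lin_bounded (norm (?f \<one>)) K ?f"
    using lin_bounded_of_increments by blast
  then show "(\<lambda>g. norm (complex_of_real (pmf \<mu> g) * ?f (k \<otimes> g))) summable_on carrier G"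
    using abs_summable_translate k by blast
  have "((\<lambda>g. ?f k * complex_of_real (pmf \<mu> g) + complex_of_real (pmf \<mu> g) * \<phi> (ab_class G g))
      has_sum ?f k) (carrier G)"
    using has_sum_add[OF has_sum_cmult_right[OF has_sum_of_real[OF has_sum_pmf], of "?f k"]
        has_sum_Hom_ab_of_abelian_centered[OF cen \<phi>]] by simp
  moreover have "?f k * complex_of_real (pmf \<mu> g) + complex_of_real (pmf \<mu> g) * \<phi> (ab_class G g)
      = complex_of_real (pmf \<mu> g) * ?f (k \<otimes> g)" if "g \<in> carrier G" for g
    using Hom_ab_add[OF \<phi> k that] k that by (simp add: affine_fun_def algebra_simps)
  ultimately have "((\<lambda>g. complex_of_real (pmf \<mu> g) * ?f (k \<otimes> g)) has_sum ?f k) (carrier G)"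
    by (simp cong: has_sum_cong)
  then show "?f k = (\<Sum>\<^sub>\<infinity>g \<in> carrier G. complex_of_real (pmf \<mu> g) * ?f (k \<otimes> g))"
    by (simp add: infsumI)
qed

end

theorem theorem1:
  fixes G :: "('a, 'b) monoid_scheme" and S :: "'a set" and \<mu> :: "'a pmf"
  assumes "nilpotent_group G"
    and "finite_symmetric_generating_set G S"
    and "set_pmf \<mu> \<subseteq> carrier G"
    and "adapted G \<mu>"
    and "smooth_measure G S \<mu>"
    and "abelian_centered G \<mu>"
  shows "HF1 G S \<mu> = LHF G S \<mu> \<and> LHF G S \<mu> = P1 G \<and>
    (\<forall>f \<in> HF1 G S \<mu>. \<exists>c. \<exists>\<phi> \<in> Hom_ab G. \<forall>x \<in> carrier G. f x = c + \<phi> (ab_class G x)) \<and>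
    linear_iso_sum_complex (carrier (abelianization G)) (Hom_ab G) (carrier G) (LHF G S \<mu>)
      (\<lambda>(\<phi>, c). affine_fun G \<phi> c)"
proof -
  interpret group G using assms(1) by (simp add: nilpotent_group_def)
  obtain \<zeta> where \<zeta>: "0 < \<zeta>"
    and exp_moment: "(\<lambda>x. pmf \<mu> x * exp (\<zeta> * real (word_length G S x))) summable_on carrier G"
    using assms(5) unfolding smooth_measure_def by blast
  \<comment> \<open>The inequality \<open>t \<le> exp t\<close> at
    \<open>t = \<zeta> * word_length G S g\<close> turns the exponential moment into the first
    moment.\<close>
  have moment: "(\<lambda>g. pmf \<mu> g * real (word_length G S g)) summable_on carrier G"
  proof (rule summable_on_comparison_test)
    show "(\<lambda>g. 1 / \<zeta> * (pmf \<mu> g * exp (\<zeta> * real (word_length G S g)))) summable_on carrier G"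
      by (rule summable_on_cmult_right[OF exp_moment])
    show "pmf \<mu> g * real (word_length G S g) \<le> 1 / \<zeta> * (pmf \<mu> g * exp (\<zeta> * real (word_length G S g)))" for g
    proof -
      have "\<zeta> * real (word_length G S g) \<le> exp (\<zeta> * real (word_length G S g))"
        using exp_ge_add_one_self[of "\<zeta> * real (word_length G S g)"] by linarith
      then have "real (word_length G S g) \<le> 1 / \<zeta> * exp (\<zeta> * real (word_length G S g))"
        using \<zeta> by (simp add: field_simps)
      then have "pmf \<mu> g * real (word_length G S g) \<le> pmf \<mu> g * (1 / \<zeta> * exp (\<zeta> * real (word_length G S g)))"
        by (intro mult_left_mono) auto
      then show ?thesis by (simp add: mult.left_commute)
    qed
  qed auto
  interpret nilpotent_random_walk G S \<mu>
    by unfold_locales (use assms moment in auto)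
  \<comment> \<open>The first of three inclusions that close a cycle through
    \<open>affine_funs\<close>, \<open>LHF\<close> and \<open>HF1\<close>.\<close>
  have HF1_affine: "HF1 G S \<mu> \<subseteq> affine_funs"
  proof
    fix f assume "f \<in> HF1 G S \<mu>"
    then have f: "f \<in> extensional (carrier G)" "harmonic G \<mu> f" "\<exists>A B. lin_bounded A B f"
      unfolding HF1_def limsup_max_on_ball_finite_iff by blast+
    then obtain A B where "lin_bounded A B f" by blast
    with f show "f \<in> affine_funs"
      using linear_growth_harmonic_affine by (intro affine_funs_of_additive) blast+
  qed
  have affine_LHF: "affine_funs \<subseteq> LHF G S \<mu>"
  proof clarify
    fix \<phi> c assume \<phi>: "\<phi> \<in> Hom_ab G"
    then show "affine_fun G \<phi> c \<in> LHF G S \<mu>"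
      unfolding LHF_def gradient_norm_finite_iff
      using harmonic_affine_fun[OF assms(6) \<phi>] Hom_ab_increments_bounded[OF \<phi>]
      by (auto simp: affine_fun_def)
  qed
  have LHF_HF1: "LHF G S \<mu> \<subseteq> HF1 G S \<mu>"
    using lin_bounded_of_increments
    unfolding LHF_def HF1_def gradient_norm_finite_iff limsup_max_on_ball_finite_iff by blast
  have HF1: "HF1 G S \<mu> = affine_funs" and LHF: "LHF G S \<mu> = affine_funs"
    using HF1_affine affine_LHF LHF_HF1 by blast+
  have "\<exists>c. \<exists>\<phi> \<in> Hom_ab G. \<forall>x \<in> carrier G. f x = c + \<phi> (ab_class G x)"
    if f: "f \<in> HF1 G S \<mu>" for f
  proof -
    obtain \<phi> c where \<phi>: "\<phi> \<in> Hom_ab G" and "f = affine_fun G \<phi> c"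
      using f unfolding HF1 by auto
    then have "\<forall>x \<in> carrier G. f x = c + \<phi> (ab_class G x)"
      by (simp add: affine_fun_def)
    with \<phi> show ?thesis by blast
  qed
  then show ?thesis
    using linear_iso_affine_funs unfolding HF1 LHF P1_eq_affine_funs by blast
qed

end
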